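(* Let $\varepsilon$ and $\delta$ be arbitrary but fixed positive numbers, let $n,r$ be positive integers, and let $u=n/r$. Then $$\kappa(n,r)=e^{-H_r}+O_{\varepsilon,\delta}\left(\frac{\varrho(u)}{r}\exp\left\{-\frac{2u(1-\delta)}{\pi^2(\log(1+u))^2}\right\}\right)$$ if $(\log n)^{3+\varepsilon}\le r<n$. Moreover, $$\kappa(n,r)=e^{-H_r}+O\left(\frac{\varrho(u)\,u^{u/r}}{r}\right)$$ if $\log n\le r<(\log n)^{3+\varepsilon}$.
   Context: $S_n$ is the symmetric group on $n$ symbols and $k_j(\sigma)$ is the number of cycles of length $j$ in $\sigma\in S_n$. For $1\le r<n$ (a standing assumption), $$\kappa(n,r)=\frac1{n!}\left|\{\sigma\in S_n:\ k_j(\sigma)=0\text{ for all }1\le j\le r\}\right|.$$ $H_r=\sum_{j=1}^r1/j$. $\varrho$ is the Dickman function: the continuous function on $[0,\infty)$ with $\varrho(v)=1$ for $v\in[0,1]$ and $v\varrho'(v)+\varrho(v-1)=0$ for $v>1$. The implied constant in $O_{\varepsilon,\delta}$ may depend on $\varepsilon,\delta$ only; the implied constant in an unindexed $O$ is absolute; both are uniform over $n,r$ in the stated ranges. $\log$ is the natural logarithm. *)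

theory Defs
  imports "HOL-Analysis.Analysis" "HOL-Combinatorics.Orbits"
begin

text \<open>
  On a finite set \<open>A\<close> the cycles of a permutation of \<open>A\<close> are its orbits; fixed points are
  the cycles of length 1.
\<close>

definition cycle_count :: "'a set \<Rightarrow> ('a \<Rightarrow> 'a) \<Rightarrow> nat \<Rightarrow> nat" where
  "cycle_count A \<sigma> j = card {c \<in> orbit \<sigma> ` A. card c = j}"

definition kappa :: "nat \<Rightarrow> nat \<Rightarrow> real" where
  "kappa n r =
     real (card {\<sigma>. \<sigma> permutes {1..n} \<and> (\<forall>j\<in>{1..r}. cycle_count {1..n} \<sigma> j = 0)}) / fact n"

text \<open>
  The Dickman function lives on \<open>[0,\<infinity>)\<close>. HOL functions are total, so the
  value 0 is prescribed on the negative axis; this makes the function unique and is otherwise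
  irrelevant.
\<close>

definition is_dickman :: "(real \<Rightarrow> real) \<Rightarrow> bool" where
  "is_dickman f \<longleftrightarrow>
     continuous_on {0..} f \<and>
     (\<forall>v\<in>{0..1}. f v = 1) \<and>
     (\<forall>v>1. f differentiable (at v) \<and> v * deriv f v + f (v - 1) = 0) \<and>
     (\<forall>v<0. f v = 0)"

definition dickman :: "real \<Rightarrow> real" where
  "dickman = (THE f. is_dickman f)"

text \<open>
  Existence and uniqueness, so that the definite description above is meaningful. The
  iterates of the integral operator below, started from the constant 1, stabilise
  on each bounded interval after finitely many steps.
\<close>

definition dickman_op :: "(real \<Rightarrow> real) \<Rightarrow> real \<Rightarrow> real" where
  "dickman_op g v = 1 - integral {1..max 1 v} (\<lambda>t. g (t - 1) / t)"

lemma dickman_op_le_1: "v \<le> 1 \<Longrightarrow> dickman_op g v = 1"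
  by (simp add: dickman_op_def max_def)

lemma dickman_op_cong:
  assumes "\<And>t. 0 \<le> t \<Longrightarrow> t \<le> v - 1 \<Longrightarrow> g t = h t"
  shows "dickman_op g v = dickman_op h v"
proof (cases "v \<le> 1")
  case True
  then show ?thesis by (simp add: dickman_op_le_1)
next
  case False
  then have "integral {1..max 1 v} (\<lambda>t. g (t - 1) / t) = integral {1..max 1 v} (\<lambda>t. h (t - 1) / t)"
    by (intro integral_cong) (use assms in auto)
  then show ?thesis by (simp add: dickman_op_def)
qed

lemma continuous_on_dickman_integrand:
  assumes "continuous_on {0..} g"
  shows "continuous_on {1..b} (\<lambda>t. g (t - 1) / t :: real)"
  by (intro continuous_intros continuous_on_compose2[OF assms]) auto

lemma continuous_on_dickman_op:
  assumes "continuous_on {0..} g"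
  shows "continuous_on A (dickman_op g)"
proof -
  let ?h = "\<lambda>t. g (t - 1) / t"
  have "isCont (dickman_op g) x" for x
  proof -
    define b where "b = max 1 x + 1"
    have "continuous_on {1..b} (\<lambda>y. integral {1..y} ?h)"
      by (intro indefinite_integral_continuous_1 integrable_continuous_real
            continuous_on_dickman_integrand assms)
    then have "continuous_on {..<b} (\<lambda>v. integral {1..max 1 v} ?h)"
      by (rule continuous_on_compose2) (auto simp: b_def intro!: continuous_intros)
    then have "continuous_on {..<b} (dickman_op g)"
      unfolding dickman_op_def [abs_def] by (intro continuous_intros)
    moreover have "x \<in> {..<b}" by (simp add: b_def)
    ultimately show ?thesis
      using continuous_on_eq_continuous_at open_lessThan by blast
  qed
  then show ?thesis by (simp add: continuous_at_imp_continuous_on)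
qed

lemma has_real_derivative_dickman_op:
  assumes "continuous_on {0..} g" "v > 1"
  shows "(dickman_op g has_real_derivative - (g (v - 1) / v)) (at v)"
proof -
  let ?h = "\<lambda>t. g (t - 1) / t"
  have "((\<lambda>x. integral {1..x} ?h) has_real_derivative ?h v) (at v within {1..v + 1})"
    by (rule integral_has_real_derivative)
       (use assms continuous_on_dickman_integrand in auto)
  moreover have "at v within {1..v + 1} = at v"
    using assms by (intro at_within_interior) (auto simp: interior_atLeastAtMost_real)
  ultimately have "((\<lambda>x. integral {1..x} ?h) has_real_derivative ?h v) (at v)"
    by simp
  then have "((\<lambda>x. 1 - integral {1..x} ?h) has_real_derivative - ?h v) (at v)"
    by (auto intro!: derivative_eq_intros)
  then show ?thesis
    by (rule has_field_derivative_transform_within_open[where S = "{1<..}"])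
       (use assms in \<open>auto simp: dickman_op_def max_def\<close>)
qed

lemma dickman_exists: "\<exists>f. is_dickman f"
proof -
  define G where "G n = (dickman_op ^^ n) (\<lambda>_. 1)" for n
  have G_Suc: "G (Suc n) = dickman_op (G n)" for n
    by (simp add: G_def)
  have G_cont: "continuous_on {0..} (G n)" for n
    by (induction n) (simp add: G_def, simp add: G_Suc continuous_on_dickman_op)
  have step: "G (Suc n) v = G n v" if "v \<le> real (Suc n)" for n v
    using that
  proof (induction n arbitrary: v)
    case 0
    then show ?case by (simp add: G_def dickman_op_le_1)
  next
    case (Suc n)
    show ?case
      by (subst (1 2) G_Suc, rule dickman_op_cong) (use Suc in auto)
  qed
  have stable: "G (n + k) v = G n v" if "v \<le> real (Suc n)" for n k v
    using that by (induction k) (simp_all add: step)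
  define F where "F v = G (nat \<lceil>v\<rceil>) v" for v
  have F_eq: "F v = G n v" if "v \<le> real n" for n v
  proof -
    have "nat \<lceil>v\<rceil> \<le> n" using that by linarith
    then obtain k where "n = nat \<lceil>v\<rceil> + k" using le_Suc_ex by blast
    moreover have "v \<le> real (Suc (nat \<lceil>v\<rceil>))" by linarith
    ultimately show ?thesis by (simp add: F_def stable)
  qed
  have F_cont: "continuous_on {0..} F"
  proof -
    have "continuous (at x within {0..}) F" if "x \<in> {0..}" for x
    proof -
      define n where "n = nat \<lceil>x\<rceil> + 1"
      have x: "x < real n" by (simp add: n_def) linarith
      have "continuous_on {0..<real n} F \<longleftrightarrow> continuous_on {0..<real n} (G n)"
        by (rule continuous_on_cong) (auto simp: F_eq)
      then have "continuous_on {0..<real n} F"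
        using continuous_on_subset[OF G_cont, of "{0..<real n}" n] by (simp add: subset_iff)
      then have "continuous (at x within {0..<real n}) F"
        using x that by (simp add: continuous_on_eq_continuous_within)
      moreover have "at x within {0..<real n} = at x within {0..}"
        by (rule at_within_nhd[of _ "{..<real n}"]) (use x in auto)
      ultimately show ?thesis by simp
    qed
    then show ?thesis by (simp add: continuous_on_eq_continuous_within)
  qed
  have fix_F: "dickman_op F v = F v" for v
  proof -
    define n where "n = nat \<lceil>v\<rceil>"
    have v: "v \<le> real n" by (simp add: n_def) linarith
    have "dickman_op F v = dickman_op (G n) v"
      by (rule dickman_op_cong) (use v in \<open>simp add: F_eq\<close>)
    also have "\<dots> = G (Suc n) v" by (simp add: G_Suc)
    also have "\<dots> = F v" using v by (simp add: F_eq[of v "Suc n"])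
    finally show ?thesis .
  qed
  define f where "f v = (if v < 0 then 0 else F v)" for v
  have "continuous_on {0..} f"
    using F_cont by (rule continuous_on_eq) (simp add: f_def)
  moreover have "f v = 1" if "v \<in> {0..1}" for v
    using that fix_F[of v] by (simp add: f_def dickman_op_le_1)
  moreover have "f differentiable (at v) \<and> v * deriv f v + f (v - 1) = 0" if "v > 1" for v
  proof -
    have "(F has_real_derivative - (F (v - 1) / v)) (at v)"
      using has_real_derivative_dickman_op[OF F_cont that] by (simp add: fix_F [abs_def])
    then have D: "(f has_real_derivative - (F (v - 1) / v)) (at v)"
      by (rule has_field_derivative_transform_within_open[where S = "{0<..}"])
         (use that in \<open>auto simp: f_def\<close>)
    then have "f differentiable (at v)"
      using real_differentiable_def by blast
    moreover have "v * deriv f v + f (v - 1) = 0"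
      using that by (simp add: DERIV_imp_deriv[OF D] f_def)
    ultimately show ?thesis by blast
  qed
  ultimately have "is_dickman f"
    by (auto simp: is_dickman_def f_def)
  then show ?thesis by blast
qed

lemma dickman_unique:
  assumes "is_dickman f" "is_dickman g"
  shows "f = g"
proof -
  have eq: "f v = g v" if "v \<le> real (Suc n)" for n v
    using that
  proof (induction n arbitrary: v)
    case 0
    then show ?case using assms by (cases "v < 0") (auto simp: is_dickman_def)
  next
    case (Suc n)
    define a where "a = real (Suc n)"
    have a: "a \<ge> 1" by (simp add: a_def)
    have IH: "f v = g v" if "v \<le> a" for v
      using Suc.IH that by (simp add: a_def)
    show ?case
    proof (cases "v \<le> a")
      case True
      then show ?thesis by (rule IH)
    next
      case False
      have "f v - g v = f a - g a"
      proof (rule DERIV_isconst2[where f = "\<lambda>x. f x - g x" and b = "a + 1"])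
        have "continuous_on {a..a + 1} f" "continuous_on {a..a + 1} g"
          using assms a by (auto simp: is_dickman_def intro: continuous_on_subset)
        then show "continuous_on {a..a + 1} (\<lambda>x. f x - g x)"
          by (rule continuous_on_diff)
        fix x assume x: "a < x" "x < a + 1"
        have "(f has_real_derivative deriv f x) (at x)" "(g has_real_derivative deriv g x) (at x)"
          using assms a x
          by (auto simp: is_dickman_def DERIV_deriv_iff_real_differentiable)
        moreover have "deriv f x = deriv g x"
        proof -
          have "x * deriv f x + f (x - 1) = x * deriv g x + g (x - 1)"
            using assms a x by (simp add: is_dickman_def)
          then show ?thesis using IH[of "x - 1"] a x by simp
        qed
        ultimately show "((\<lambda>x. f x - g x) has_real_derivative 0) (at x)"
          using DERIV_diff by fastforce
      qed (use False Suc.prems a in \<open>auto simp: a_def\<close>)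
      then show ?thesis using IH[of a] by simp
    qed
  qed
  show ?thesis
  proof
    fix v
    have "v \<le> real (Suc (nat \<lceil>v\<rceil>))" by linarith
    then show "f v = g v" by (rule eq)
  qed
qed

lemma is_dickman_dickman: "is_dickman dickman"
  unfolding dickman_def using dickman_exists dickman_unique by (metis theI)

end

theory Submission
  imports Defs "HOL-Complex_Analysis.Complex_Analysis" "HOL-Real_Asymp.Real_Asymp"
begin

text \<open>
  Let \<open>u = n/r\<close>, let \<open>\<rho>\<close> be the Dickman function, and write
  \<open>Q(z) = exp (- (z + z^2/2 + \<dots> + z^r/r))\<close>. The generating function of the numbers
  \<open>\<kappa>(n,r)\<close> is \<open>K(z) = Q(z) / (1 - z)\<close>, and
  \<open>Q(1) = e^{-H_r}\<close>. Since \<open>Q\<close> is entire, the only pole of \<open>K\<close>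
  is the one at 1, and moving the contour of Cauchy's formula across it leaves
  \<open>\<kappa>(n,r) - e^{-H_r} = (1 / 2 \<pi> \<i>) \<integral> K(z) z^{-n-1} dz\<close> over any
  circle of radius \<open>x > 1\<close>. Two integrations by parts make the integrand decay away from
  1 (\<open>kappa_contour_integral_decaying\<close>), which produces the factor \<open>1/r\<close> of
  the theorem (\<open>kappa_error_le_max\<close>). What remains is to bound \<open>K\<close> on the
  circle.

  The radius is \<open>x = e^{s/r}\<close> with \<open>s = \<xi>(u)\<close>, the solution of
  \<open>(e^s - 1) / s = u\<close>. This is the saddle point that governs \<open>\<rho>(u)\<close>:
  with \<open>L(u) = u \<xi>(u) - E(\<xi>(u))\<close> and \<open>E\<close> a primitive of
  \<open>(e^s - 1) / s\<close>, the size of \<open>\<rho>(u)\<close> is \<open>e^{-L(u)}\<close> up to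
  powers of \<open>u\<close>. For permutations with no long cycles the exponent would be
  \<open>\<Sum> (x^j - 1) / j\<close>, which exceeds \<open>E(s)\<close> by at most
  \<open>3 u s / (4 r) + O(1)\<close> (\<open>sum_expm1_le_ein\<close>); the factor
  \<open>u^{u/r}\<close> pays for this discretisation. Here the sign in \<open>Q\<close> is reversed,
  so \<open>|K|\<close> reaches that size only if all powers \<open>z^j\<close> point to the negative
  axis. They cannot: either \<open>z/x\<close> is within \<open>1/r\<close> of 1, and then
  \<open>z^j\<close> has nonnegative real part for all \<open>j \<le> r\<close>, or the geometric sum
  \<open>\<Sum> z^j\<close> is visibly smaller than \<open>\<Sum> x^j\<close>. This saves a factor
  \<open>exp (- c u / s^2)\<close> (\<open>phase_saving\<close>, \<open>norm_kappa_gf_le\<close>),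
  where \<open>c\<close> is close to \<open>1/2\<close> if \<open>s\<close> is small against
  \<open>r\<close>, and about \<open>0.29\<close> can be guaranteed for \<open>s \<le> 1.2 r\<close>.
  As \<open>s\<close> is asymptotic to \<open>ln u\<close> and \<open>c\<close> exceeds
  \<open>2 / \<pi>^2\<close> (about \<open>0.203\<close>) with room to spare, all powers of
  \<open>u\<close> lost on the way are absorbed.

  For the lower bound \<open>\<rho>(u) \<ge> e^{-L(u)} / poly(u)\<close> no asymptotic analysis is
  needed. Convexity of \<open>L\<close> shows that \<open>g(u) = e^{-L(u + 2)}\<close> satisfies
  \<open>u g(u) < \<integral> g\<close> over \<open>[u - 1, u]\<close>, whereas \<open>\<rho>\<close>
  satisfies this with equality; so \<open>\<rho>\<close> cannot fall below a multiple of
  \<open>g\<close> that it dominates on \<open>[0, 1]\<close>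
  (\<open>dickman_minorant_subsolution\<close>, \<open>dickman_ge_minorant\<close>).

  All this gives one bound valid for \<open>r \<ge> ln n\<close> (\<open>kappa_error\<close>): the
  error is at most a constant times \<open>\<rho>(u) / r\<close> times
  \<open>u^{u/r} exp (- 0.21 u / ln^2 (1 + u))\<close>. The second assertion drops the exponential
  factor. In the first one \<open>r \<ge> (ln n)^{3 + \<epsilon>}\<close> makes
  \<open>u ln u / r\<close> negligible against \<open>u / ln^2 u\<close>.
\<close>

section \<open>Splitting off a cycle\<close>

definition long_cycle_perms :: "nat \<Rightarrow> 'a set \<Rightarrow> ('a \<Rightarrow> 'a) set" where
  "long_cycle_perms r A = {\<sigma>. \<sigma> permutes A \<and> (\<forall>x\<in>A. r < card (orbit \<sigma> x))}"

definition full_cycles :: "'a \<Rightarrow> 'a set \<Rightarrow> ('a \<Rightarrow> 'a) set" where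
  "full_cycles a C = {\<tau>. \<tau> permutes C \<and> orbit \<tau> a = C}"

lemma perm_restrict_permutes:
  assumes "finite S" "inj \<sigma>" "\<sigma> ` S \<subseteq> S"
  shows "perm_restrict \<sigma> S permutes S"
proof (rule bij_imp_permutes)
  have "inj_on \<sigma> S" using assms(2) inj_on_subset by blast
  then have "bij_betw \<sigma> S S"
    by (simp add: assms bij_betw_def endo_inj_surj)
  then show "bij_betw (perm_restrict \<sigma> S) S S"
    by (rule bij_betw_cong[THEN iffD1, rotated]) (simp add: perm_restrict_def)
qed (simp add: perm_restrict_def)

lemma disjoint_comp_apply:
  assumes "\<tau> permutes C" "\<pi> permutes B" "C \<inter> B = {}"
  shows "x \<in> C \<Longrightarrow> (\<tau> \<circ> \<pi>) x = \<tau> x" "x \<in> B \<Longrightarrow> (\<tau> \<circ> \<pi>) x = \<pi> x"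
proof -
  show "(\<tau> \<circ> \<pi>) x = \<tau> x" if "x \<in> C"
  proof -
    have "x \<notin> B" using that assms by auto
    then show ?thesis using assms(2) by (simp add: permutes_not_in)
  qed
  show "(\<tau> \<circ> \<pi>) x = \<pi> x" if "x \<in> B"
  proof -
    have "\<pi> x \<in> B" using that assms(2) by (simp add: permutes_in_image)
    then have "\<pi> x \<notin> C" using assms by auto
    then show ?thesis using assms(1) by (simp add: permutes_not_in)
  qed
qed

lemma disjoint_comp_orbit:
  assumes "\<tau> permutes C" "\<pi> permutes B" "C \<inter> B = {}"
  shows "x \<in> C \<Longrightarrow> orbit (\<tau> \<circ> \<pi>) x = orbit \<tau> x" "x \<in> B \<Longrightarrow> orbit (\<tau> \<circ> \<pi>) x = orbit \<pi> x"
proof -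
  show "orbit (\<tau> \<circ> \<pi>) x = orbit \<tau> x" if "x \<in> C"
    by (rule orbit_cong0[symmetric, OF that])
       (use assms disjoint_comp_apply(1)[OF assms] in \<open>auto simp: permutes_in_image\<close>)
  show "orbit (\<tau> \<circ> \<pi>) x = orbit \<pi> x" if "x \<in> B"
    by (rule orbit_cong0[symmetric, OF that])
       (use assms disjoint_comp_apply(2)[OF assms] in \<open>auto simp: permutes_in_image\<close>)
qed

text \<open>
  The inverse restricts a permutation to its cycle through \<open>a\<close> and to the complement of that
  cycle; the orbits of a product of permutations of disjoint sets are those of the factors.
\<close>

lemma bij_betw_split_cycle:
  assumes A: "finite A" "C \<subseteq> A" "a \<in> C" "r < card C"
  shows "bij_betw (\<lambda>(\<tau>, \<pi>). \<tau> \<circ> \<pi>) (full_cycles a C \<times> long_cycle_perms r (A - C))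
           {\<sigma> \<in> long_cycle_perms r A. orbit \<sigma> a = C}"
proof (rule bij_betw_byWitness[where f' = "\<lambda>\<sigma>. (perm_restrict \<sigma> C, perm_restrict \<sigma> (A - C))"])
  let ?S = "full_cycles a C \<times> long_cycle_perms r (A - C)"
  have disj: "C \<inter> (A - C) = {}" by auto
  show "\<forall>p\<in>?S. (perm_restrict (case p of (\<tau>, \<pi>) \<Rightarrow> \<tau> \<circ> \<pi>) C,
                 perm_restrict (case p of (\<tau>, \<pi>) \<Rightarrow> \<tau> \<circ> \<pi>) (A - C)) = p"
  proof (clarify)
    fix \<tau> \<pi> assume "\<tau> \<in> full_cycles a C" "\<pi> \<in> long_cycle_perms r (A - C)"
    then have p: "\<tau> permutes C" "\<pi> permutes (A - C)"
      by (auto simp: full_cycles_def long_cycle_perms_def)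
    have "perm_restrict (\<tau> \<circ> \<pi>) C x = \<tau> x" for x
      using disjoint_comp_apply(1)[OF p disj] p(1)
      by (cases "x \<in> C") (auto simp: perm_restrict_def permutes_not_in)
    moreover have "perm_restrict (\<tau> \<circ> \<pi>) (A - C) x = \<pi> x" for x
      using disjoint_comp_apply(2)[OF p disj] p(2)
      by (cases "x \<in> A - C") (auto simp: perm_restrict_def permutes_not_in simp del: Diff_iff)
    ultimately show "perm_restrict (\<tau> \<circ> \<pi>) C = \<tau> \<and> perm_restrict (\<tau> \<circ> \<pi>) (A - C) = \<pi>"
      by auto
  qed
  have restr: "perm_restrict \<sigma> C permutes C \<and> perm_restrict \<sigma> (A - C) permutes (A - C) \<and>
               perm_restrict \<sigma> C \<circ> perm_restrict \<sigma> (A - C) = \<sigma>"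
    if \<sigma>: "\<sigma> permutes A" "orbit \<sigma> a = C" for \<sigma>
  proof -
    have cyc: "cyclic_on \<sigma> C" using cyclic_on_orbit[OF \<sigma>(1) A(1), of a] \<sigma>(2) by simp
    have inj: "inj \<sigma>" using \<sigma>(1) by (rule permutes_inj)
    have fin: "finite C" "finite (A - C)" using A finite_subset by auto
    have 1: "\<sigma> ` C \<subseteq> C" using cyc by (auto intro: cyclic_on_inI)
    have 2: "\<sigma> ` (A - C) \<subseteq> A - C"
      using cyclic_on_f_in[OF \<sigma>(1) cyc] \<sigma>(1) by (auto simp: permutes_in_image)
    have p: "perm_restrict \<sigma> C permutes C" "perm_restrict \<sigma> (A - C) permutes (A - C)"
      using perm_restrict_permutes[OF fin(1) inj 1] perm_restrict_permutes[OF fin(2) inj 2] by auto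
    then have "perm_restrict \<sigma> C \<circ> perm_restrict \<sigma> (A - C) = perm_restrict \<sigma> (C \<union> (A - C))"
      by (rule perm_restrict_union) auto
    also have "C \<union> (A - C) = A" using A by auto
    finally have "perm_restrict \<sigma> C \<circ> perm_restrict \<sigma> (A - C) = \<sigma>"
      by (simp only: perm_restrict_id[OF \<sigma>(1)])
    then show ?thesis using p by blast
  qed
  then show "\<forall>\<sigma>\<in>{\<sigma> \<in> long_cycle_perms r A. orbit \<sigma> a = C}.
      (case (perm_restrict \<sigma> C, perm_restrict \<sigma> (A - C)) of (\<tau>, \<pi>) \<Rightarrow> \<tau> \<circ> \<pi>) = \<sigma>"
    by (auto simp: long_cycle_perms_def)
  show "(\<lambda>(\<tau>, \<pi>). \<tau> \<circ> \<pi>) ` ?S \<subseteq> {\<sigma> \<in> long_cycle_perms r A. orbit \<sigma> a = C}"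
  proof (clarify)
    fix \<tau> \<pi> assume h: "\<tau> \<in> full_cycles a C" "\<pi> \<in> long_cycle_perms r (A - C)"
    then have p: "\<tau> permutes C" "\<pi> permutes (A - C)" "orbit \<tau> a = C"
      by (auto simp: full_cycles_def long_cycle_perms_def)
    note o = disjoint_comp_orbit[OF p(1,2) disj]
    have "\<tau> \<circ> \<pi> permutes A"
      using p A by (intro permutes_compose permutes_subset[OF p(1)] permutes_subset[OF p(2)]) auto
    moreover have "r < card (orbit (\<tau> \<circ> \<pi>) x)" if "x \<in> A" for x
    proof (cases "x \<in> C")
      case True
      have fin: "finite C" using A finite_subset by auto
      have "cyclic_on \<tau> C" using cyclic_on_orbit[OF p(1) fin, of a] p(3) by simp
      then have "orbit \<tau> x = C" using True orbit_cyclic_eq3 by metis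
      then show ?thesis using o(1)[OF True] A by simp
    next
      case False
      then show ?thesis using o(2)[of x] h(2) that by (auto simp: long_cycle_perms_def)
    qed
    ultimately show "\<tau> \<circ> \<pi> \<in> long_cycle_perms r A \<and> orbit (\<tau> \<circ> \<pi>) a = C"
      using o(1)[OF A(3)] p(3) by (auto simp: long_cycle_perms_def)
  qed
  show "(\<lambda>\<sigma>. (perm_restrict \<sigma> C, perm_restrict \<sigma> (A - C))) `
      {\<sigma> \<in> long_cycle_perms r A. orbit \<sigma> a = C} \<subseteq> ?S"
  proof (clarify)
    fix \<sigma> assume h: "\<sigma> \<in> long_cycle_perms r A" "C = orbit \<sigma> a"
    then have "\<sigma> permutes A" by (simp add: long_cycle_perms_def)
    note R = restr[OF this h(2)[symmetric]]
    note o = disjoint_comp_orbit[OF R[THEN conjunct1] R[THEN conjunct2, THEN conjunct1] disj]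
    have o1: "orbit (perm_restrict \<sigma> C) x = orbit \<sigma> x" if "x \<in> C" for x
      using o(1)[OF that] R by simp
    have o2: "orbit (perm_restrict \<sigma> (A - C)) x = orbit \<sigma> x" if "x \<in> A - C" for x
      using o(2)[OF that] R by simp
    have "perm_restrict \<sigma> C \<in> full_cycles a C"
      using R o1[OF A(3)] h(2) by (simp add: full_cycles_def)
    moreover have "perm_restrict \<sigma> (A - C) \<in> long_cycle_perms r (A - C)"
      using R o2 h(1) by (auto simp: long_cycle_perms_def)
    ultimately show "perm_restrict \<sigma> (orbit \<sigma> a) \<in> full_cycles a (orbit \<sigma> a) \<and>
       perm_restrict \<sigma> (A - orbit \<sigma> a) \<in> long_cycle_perms r (A - orbit \<sigma> a)"
      using h(2) by simp
  qed
qed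

lemma finite_long_cycle_perms: "finite A \<Longrightarrow> finite (long_cycle_perms r A)"
  unfolding long_cycle_perms_def by (rule finite_subset[OF _ finite_permutations]) auto

lemma card_long_cycle_perms_split:
  assumes A: "finite A" "a \<in> A"
  shows "card (long_cycle_perms r A) =
    (\<Sum>C | C \<subseteq> A \<and> a \<in> C \<and> r < card C. card (full_cycles a C) * card (long_cycle_perms r (A - C)))"
proof -
  let ?I = "{C. C \<subseteq> A \<and> a \<in> C \<and> r < card C}"
  let ?X = "\<lambda>C. {\<sigma> \<in> long_cycle_perms r A. orbit \<sigma> a = C}"
  have finI: "finite ?I" using A by auto
  have "long_cycle_perms r A = (\<Union>C\<in>?I. ?X C)"
  proof (intro equalityI subsetI)
    fix \<sigma> assume h: "\<sigma> \<in> long_cycle_perms r A"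
    then have s: "\<sigma> permutes A" by (simp add: long_cycle_perms_def)
    have "permutation \<sigma>" using s A by (auto simp: permutation_permutes)
    then have "a \<in> orbit \<sigma> a" by (rule permutation_self_in_orbit)
    moreover have "orbit \<sigma> a \<subseteq> A" by (rule permutes_orbit_subset[OF s A(2)])
    ultimately show "\<sigma> \<in> (\<Union>C\<in>?I. ?X C)" using h A by (auto simp: long_cycle_perms_def)
  qed auto
  then have "card (long_cycle_perms r A) = card (\<Union>C\<in>?I. ?X C)" by simp
  also have "\<dots> = (\<Sum>C\<in>?I. card (?X C))"
    by (rule card_UN_disjoint) (use finI finite_long_cycle_perms[OF A(1)] in auto)
  also have "\<dots> = (\<Sum>C\<in>?I. card (full_cycles a C) * card (long_cycle_perms r (A - C)))"
  proof (rule sum.cong)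
    fix C assume "C \<in> ?I"
    then have "card (full_cycles a C \<times> long_cycle_perms r (A - C)) = card (?X C)"
      using bij_betw_same_card[OF bij_betw_split_cycle[of A C a r]] A by auto
    then show "card (?X C) = card (full_cycles a C) * card (long_cycle_perms r (A - C))"
      by (simp add: card_cartesian_product)
  qed simp
  finally show ?thesis .
qed

lemma long_cycle_perms_0:
  assumes "finite A" shows "long_cycle_perms 0 A = {\<sigma>. \<sigma> permutes A}"
proof -
  have "0 < card (orbit \<sigma> x)" if "\<sigma> permutes A" "x \<in> A" for \<sigma> x
    using finite_subset[OF permutes_orbit_subset[OF that] assms] orbit_nonempty[of \<sigma> x]
    by (simp add: card_gt_0_iff)
  then show ?thesis by (auto simp: long_cycle_perms_def)
qed

lemma card_subsets_containing:
  assumes "finite A" "a \<in> A" "j > 0"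
  shows "card {C. C \<subseteq> A \<and> a \<in> C \<and> card C = j} = (card A - 1) choose (j - 1)"
proof -
  have "{C. C \<subseteq> A \<and> a \<in> C \<and> card C = j} = insert a ` {D. D \<subseteq> A - {a} \<and> card D = j - 1}"
    (is "?L = ?R")
  proof (intro equalityI subsetI)
    fix C assume C: "C \<in> ?L"
    then have "C = insert a (C - {a})" "C - {a} \<subseteq> A - {a}" by auto
    moreover have "card (C - {a}) = j - 1" using C by (simp add: card_Diff_singleton_if)
    ultimately show "C \<in> ?R" by blast
  next
    fix C assume "C \<in> ?R"
    then obtain D where D: "C = insert a D" "D \<subseteq> A - {a}" "card D = j - 1" by auto
    have "finite D" using D(2) assms(1) finite_subset by blast
    then have "card C = Suc (card D)" using D by (simp add: card_insert_if subset_Diff_insert)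
    then show "C \<in> ?L" using D assms by auto
  qed
  moreover have "inj_on (insert a) {D. D \<subseteq> A - {a} \<and> card D = j - 1}"
    by (rule inj_onI) (metis (no_types, lifting) Diff_insert_absorb mem_Collect_eq subset_Diff_insert)
  ultimately have "card ?L = card {D. D \<subseteq> A - {a} \<and> card D = j - 1}"
    by (simp add: card_image)
  also have "\<dots> = (card A - 1) choose (j - 1)"
    using assms by (simp add: n_subsets)
  finally show ?thesis .
qed

lemma choose_mult_facts:
  assumes "1 \<le> j" "j \<le> n"
  shows "real ((n - 1) choose (j - 1)) * (fact (j - 1) * fact (n - j)) = fact (n - 1)"
proof -
  have "fact (j - 1) * fact (n - 1 - (j - 1)) * ((n - 1) choose (j - 1)) = fact (n - 1)"
    using assms by (intro binomial_fact_lemma) auto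
  moreover have "n - 1 - (j - 1) = n - j" using assms by simp
  ultimately have "real (fact (j - 1) * fact (n - j) * ((n - 1) choose (j - 1))) = real (fact (n - 1))"
    by simp
  then show ?thesis by (simp add: mult_ac)
qed

text \<open>
  No enumeration of cycles is needed: for \<open>r = 0\<close> the splitting counts all permutations. By
  induction each of the \<open>n - 1\<close> proper cycle lengths accounts for \<open>(n - 1)!\<close> of them, and what
  is left of \<open>n!\<close> must be the number of full cycles.
\<close>

lemma card_full_cycles:
  assumes "finite C" "a \<in> C"
  shows "card (full_cycles a C) = fact (card C - 1)"
  using assms
proof (induction "card C" arbitrary: C rule: less_induct)
  case less
  define n where "n = card C"
  have n: "n > 0" using less by (auto simp: n_def card_gt_0_iff)
  let ?f = "\<lambda>B. card (full_cycles a B) * card (long_cycle_perms 0 (C - B))"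
  let ?P = "{B. B \<subseteq> C \<and> a \<in> B \<and> card B < n}"
  have pos: "card B > 0" if "B \<subseteq> C" "a \<in> B" for B
    using that less(2) finite_subset card_gt_0_iff by blast
  have lp: "card (long_cycle_perms 0 B) = fact (card B)" if "finite B" for B :: "'a set"
    using that by (simp add: long_cycle_perms_0 card_permutations)
  have set: "{B. B \<subseteq> C \<and> a \<in> B \<and> 0 < card B} = insert C ?P"
  proof (intro equalityI subsetI)
    fix B assume B: "B \<in> {B. B \<subseteq> C \<and> a \<in> B \<and> 0 < card B}"
    show "B \<in> insert C ?P"
    proof (cases "B = C")
      case False
      then have "card B < n" unfolding n_def using B less(2) by (intro psubset_card_mono) auto
      then show ?thesis using B by auto
    qed simp
  qed (use less(2,3) pos in auto)
  have "real (fact n) = real (card (long_cycle_perms 0 C))" by (simp add: lp less(2) n_def)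
  also have "\<dots> = real (?f C) + (\<Sum>B\<in>?P. real (?f B))"
    unfolding card_long_cycle_perms_split[OF less(2,3)] set
    using less(2) by (subst sum.insert) (auto simp: n_def)
  also have "(\<Sum>B\<in>?P. real (?f B)) = (\<Sum>B\<in>?P. fact (card B - 1) * fact (n - card B))"
  proof (rule sum.cong)
    fix B assume B: "B \<in> ?P"
    then have fin: "finite B" using less(2) finite_subset by auto
    have "card (full_cycles a B) = fact (card B - 1)"
      using B fin by (intro less(1)) (auto simp: n_def)
    moreover have "card (long_cycle_perms 0 (C - B)) = fact (n - card B)"
      using B fin less(2) by (simp add: lp card_Diff_subset n_def)
    ultimately show "real (?f B) = fact (card B - 1) * fact (n - card B)" by simp
  qed simp
  also have "\<dots> = (\<Sum>j\<in>{1..<n}. \<Sum>B | B \<in> ?P \<and> card B = j. fact (card B - 1) * fact (n - card B))"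
  proof (rule sum.group[symmetric])
    have "finite (Pow C)" using less(2) by simp
    then show "finite ?P" by (rule rev_finite_subset) auto
    show "card ` ?P \<subseteq> {1..<n}"
    proof (rule image_subsetI)
      fix B assume "B \<in> ?P"
      then show "card B \<in> {1..<n}" using pos[of B] by simp
    qed
  qed simp
  also have "\<dots> = (\<Sum>j\<in>{1..<n}. fact (n - 1))"
  proof (rule sum.cong)
    fix j assume j: "j \<in> {1..<n}"
    have "(\<Sum>B | B \<in> ?P \<and> card B = j. fact (card B - 1) * fact (n - card B)) =
          (\<Sum>B | B \<subseteq> C \<and> a \<in> B \<and> card B = j. fact (j - 1) * (fact (n - j) :: real))"
      by (rule sum.cong) (use j in auto)
    also have "\<dots> = real ((n - 1) choose (j - 1)) * (fact (j - 1) * fact (n - j))"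
      using card_subsets_containing[OF less(2,3), of j] j by (simp add: n_def)
    also have "\<dots> = fact (n - 1)"
      using j by (intro choose_mult_facts) auto
    finally show "(\<Sum>B | B \<in> ?P \<and> card B = j. fact (card B - 1) * fact (n - card B)) = (fact (n - 1) :: real)" .
  qed simp
  also have "\<dots> = real (n - 1) * fact (n - 1)" by simp
  finally have "real (card (full_cycles a C)) = fact n - real (n - 1) * fact (n - 1)"
    by (simp add: lp)
  also have "\<dots> = fact (n - 1)"
    using n by (cases n) (simp_all add: algebra_simps)
  finally have "real (card (full_cycles a C)) = real (fact (n - 1))" by simp
  then show ?case by (simp only: of_nat_eq_iff n_def)
qed

lemma kappa_conv_long_cycle_perms:
  "kappa n r = real (card (long_cycle_perms r {1..n})) / fact n"
proof -
  have "(\<forall>j\<in>{1..r}. cycle_count {1..n} \<sigma> j = 0) \<longleftrightarrow> (\<forall>x\<in>{1..n}. r < card (orbit \<sigma> x))"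
    if \<sigma>: "\<sigma> permutes {1..n}" for \<sigma>
  proof -
    have pos: "card (orbit \<sigma> x) > 0" if "x \<in> {1..n}" for x
      using finite_subset[OF permutes_orbit_subset[OF \<sigma> that]] orbit_nonempty[of \<sigma> x]
      by (simp add: card_gt_0_iff)
    have "cycle_count {1..n} \<sigma> j = 0 \<longleftrightarrow> (\<forall>x\<in>{1..n}. card (orbit \<sigma> x) \<noteq> j)" for j
      by (auto simp: cycle_count_def)
    then have "(\<forall>j\<in>{1..r}. cycle_count {1..n} \<sigma> j = 0) \<longleftrightarrow>
        (\<forall>x\<in>{1..n}. card (orbit \<sigma> x) \<notin> {1..r})"
      by auto
    also have "\<dots> \<longleftrightarrow> (\<forall>x\<in>{1..n}. r < card (orbit \<sigma> x))"
      using pos by (intro ball_cong) force+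
    finally show ?thesis .
  qed
  then have "{\<sigma>. \<sigma> permutes {1..n} \<and> (\<forall>j\<in>{1..r}. cycle_count {1..n} \<sigma> j = 0)} = long_cycle_perms r {1..n}"
    by (auto simp: long_cycle_perms_def)
  then show ?thesis by (simp add: kappa_def)
qed

lemma kappa_0: "kappa 0 r = 1"
proof -
  have "long_cycle_perms r {1..0::nat} = {id}" by (auto simp: long_cycle_perms_def)
  then show ?thesis by (simp add: kappa_conv_long_cycle_perms)
qed

text \<open>
  With \<open>n = card A\<close>, there are \<open>(n - 1) choose (j - 1)\<close> sets of size \<open>j\<close> that contain \<open>a\<close>,
  \<open>(j - 1)!\<close> cycles on each, and \<open>(n - j)! p(n - j)\<close> ways to continue. The product is
  \<open>(n - 1)! p(n - j)\<close>: the length of the cycle through a point is uniform. The function \<open>p\<close> is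
  left abstract because that the count depends on the cardinality only is proved by induction
  from this very recurrence.
\<close>

lemma card_long_cycle_perms_rec:
  assumes A: "finite A" "a \<in> A"
    and p: "\<And>B. B \<subset> A \<Longrightarrow> real (card (long_cycle_perms r B)) = fact (card B) * p (card B)"
  shows "card A * real (card (long_cycle_perms r A)) = fact (card A) * (\<Sum>m<card A - r. p m)"
proof -
  define n where "n = card A"
  let ?P = "{C. C \<subseteq> A \<and> a \<in> C \<and> r < card C}"
  have n: "n > 0" using A by (auto simp: n_def card_gt_0_iff)
  have finP: "finite ?P" by (rule finite_subset[of _ "Pow A"]) (use A in auto)
  have le: "card C \<le> n" if "C \<subseteq> A" for C using that A by (simp add: n_def card_mono)
  have "real (card (long_cycle_perms r A)) =
      (\<Sum>C\<in>?P. real (card (full_cycles a C)) * real (card (long_cycle_perms r (A - C))))"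
    by (simp add: card_long_cycle_perms_split[OF A])
  also have "\<dots> = (\<Sum>C\<in>?P. fact (card C - 1) * (fact (n - card C) * p (n - card C)))"
  proof (rule sum.cong)
    fix C assume C: "C \<in> ?P"
    then have fin: "finite C" using A(1) finite_subset by auto
    have "card (full_cycles a C) = fact (card C - 1)"
      using C fin by (intro card_full_cycles) auto
    moreover have "card (A - C) = n - card C"
      using C fin A(1) by (simp add: card_Diff_subset n_def)
    moreover have "A - C \<subset> A" using C by auto
    ultimately show "real (card (full_cycles a C)) * real (card (long_cycle_perms r (A - C))) =
        fact (card C - 1) * (fact (n - card C) * p (n - card C))"
      by (simp add: p)
  qed simp
  also have "\<dots> = (\<Sum>j\<in>{r<..n}. \<Sum>C | C \<in> ?P \<and> card C = j.
      fact (card C - 1) * (fact (n - card C) * p (n - card C)))"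
    by (rule sum.group[symmetric]) (use finP le in auto)
  also have "\<dots> = (\<Sum>j\<in>{r<..n}. fact (n - 1) * p (n - j))"
  proof (rule sum.cong)
    fix j assume j: "j \<in> {r<..n}"
    have "(\<Sum>C | C \<in> ?P \<and> card C = j. fact (card C - 1) * (fact (n - card C) * p (n - card C))) =
          (\<Sum>C | C \<subseteq> A \<and> a \<in> C \<and> card C = j. fact (j - 1) * (fact (n - j) * p (n - j)))"
      by (rule sum.cong) (use j in auto)
    also have "\<dots> = real ((n - 1) choose (j - 1)) * (fact (j - 1) * (fact (n - j) * p (n - j)))"
      using card_subsets_containing[OF A, of j] j by (simp add: n_def)
    also have "\<dots> = real ((n - 1) choose (j - 1)) * (fact (j - 1) * fact (n - j)) * p (n - j)"
      by (simp only: mult.assoc)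
    also have "\<dots> = fact (n - 1) * p (n - j)"
      using j by (subst choose_mult_facts) auto
    finally show "(\<Sum>C | C \<in> ?P \<and> card C = j. fact (card C - 1) * (fact (n - card C) * p (n - card C))) =
        fact (n - 1) * p (n - j)" .
  qed simp
  also have "\<dots> = fact (n - 1) * (\<Sum>j\<in>{r<..n}. p (n - j))"
    by (simp add: sum_distrib_left)
  also have "(\<Sum>j\<in>{r<..n}. p (n - j)) = (\<Sum>m<n - r. p m)"
    by (rule sum.reindex_bij_witness[of _ "\<lambda>m. n - m" "\<lambda>j. n - j"]) auto
  finally have "n * real (card (long_cycle_perms r A)) = (n * fact (n - 1)) * (\<Sum>m<n - r. p m)"
    by simp
  also have "n * fact (n - 1) = (fact n :: real)"
    using n by (cases n) (simp_all add: algebra_simps)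
  finally show ?thesis by (simp add: n_def)
qed

lemma card_long_cycle_perms:
  fixes A :: "nat set"
  assumes "finite A"
  shows "real (card (long_cycle_perms r A)) = fact (card A) * kappa (card A) r"
  using assms
proof (induction "card A" arbitrary: A rule: less_induct)
  case less
  define n where "n = card A"
  have *: "n * real (card (long_cycle_perms r B)) = fact n * (\<Sum>m<n - r. kappa m r)"
    if B: "card B = n" "finite B" "B \<noteq> {}" for B :: "nat set"
  proof -
    obtain b where "b \<in> B" using B by auto
    then have "card B * real (card (long_cycle_perms r B)) = fact (card B) * (\<Sum>m<card B - r. kappa m r)"
    proof (rule card_long_cycle_perms_rec[where p = "\<lambda>m. kappa m r", OF B(2)])
      fix D assume D: "D \<subset> B"
      then have "card D < card A" using psubset_card_mono[OF B(2) D] B(1) by (simp add: n_def)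
      moreover have "finite D" using D B(2) finite_subset by auto
      ultimately show "real (card (long_cycle_perms r D)) = fact (card D) * kappa (card D) r"
        by (rule less.hyps)
    qed
    then show ?thesis by (simp only: B(1))
  qed
  show ?case
  proof (cases "A = {}")
    case True
    then show ?thesis by (simp add: kappa_0 long_cycle_perms_def)
  next
    case False
    then have n: "n > 0" using less(2) by (simp add: n_def card_gt_0_iff)
    have "n * real (card (long_cycle_perms r A)) = n * real (card (long_cycle_perms r {1..n}))"
      using *[of A] *[of "{1..n}"] False less(2) n n_def by simp
    then have "real (card (long_cycle_perms r A)) = real (card (long_cycle_perms r {1..n}))"
      using n by simp
    also have "\<dots> = fact n * kappa n r" by (simp add: kappa_conv_long_cycle_perms)
    finally show ?thesis by (simp add: n_def)
  qed
qed

lemma kappa_sum_rec: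
  assumes "n > 0"
  shows "n * kappa n r = (\<Sum>m<n - r. kappa m r)"
proof -
  have "card {1..n} * real (card (long_cycle_perms r {1..n})) =
      fact (card {1..n}) * (\<Sum>m<card {1..n} - r. kappa m r)"
  proof (rule card_long_cycle_perms_rec[where p = "\<lambda>m. kappa m r" and a = 1])
    fix B assume "B \<subset> {1..n}"
    then have "finite B" using finite_subset by auto
    then show "real (card (long_cycle_perms r B)) = fact (card B) * kappa (card B) r"
      by (rule card_long_cycle_perms)
  qed (use assms in auto)
  then have "n * real (card (long_cycle_perms r {1..n})) = fact n * (\<Sum>m<n - r. kappa m r)"
    by simp
  also have "real (card (long_cycle_perms r {1..n})) = fact n * kappa n r"
    by (simp add: kappa_conv_long_cycle_perms)
  finally show ?thesis by simp
qed

text \<open>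
  Differencing removes the sum; in this form the recurrence is the coefficient version of the
  first-order differential equation of the generating function below.
\<close>

lemma kappa_rec:
  "real (Suc n) * kappa (Suc n) r = n * kappa n r + (if r \<le> n then kappa (n - r) r else 0)"
proof -
  have "Suc n - r = (if r \<le> n then Suc (n - r) else 0)" by auto
  moreover have "n * kappa n r = (\<Sum>m<n - r. kappa m r)"
    by (cases "n = 0") (auto simp: kappa_sum_rec)
  ultimately show ?thesis using kappa_sum_rec[of "Suc n" r] by simp
qed

lemma kappa_nonneg: "0 \<le> kappa n r"
  by (simp add: kappa_def)

text \<open>
  This elementary bound has the order of magnitude of \<open>exp (- harm r)\<close> and settles the theorem
  for bounded \<open>n / r\<close>.
\<close>

lemma kappa_le:
  assumes "n > 0"
  shows "kappa n r \<le> 1 / (r + 1)"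
  using assms
proof (induction n rule: less_induct)
  case (less n)
  show ?case
  proof (cases "n \<le> r")
    case True
    then have "kappa n r = 0" using kappa_sum_rec[OF less.prems, of r] less.prems by simp
    then show ?thesis by simp
  next
    case False
    then have "{..<n - r} = insert 0 {1..<n - r}" by auto
    then have "n * kappa n r = 1 + (\<Sum>m\<in>{1..<n - r}. kappa m r)"
      by (simp add: kappa_sum_rec[OF less.prems] kappa_0)
    also have "(\<Sum>m\<in>{1..<n - r}. kappa m r) \<le> (\<Sum>m\<in>{1..<n - r}. 1 / (r + 1))"
    proof (rule sum_mono)
      fix m assume "m \<in> {1..<n - r}"
      then show "kappa m r \<le> 1 / real (r + 1)" using less.IH[of m] by (auto simp: add.commute)
    qed
    also have "1 + (\<Sum>m\<in>{1..<n - r}. 1 / real (r + 1)) = 1 + (real n - (1 + real r)) / (1 + real r)"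
      using False by (simp add: of_nat_diff)
    also have "\<dots> = n * (1 / (r + 1))" by (simp add: field_simps)
    finally have "n * kappa n r \<le> n * (1 / (r + 1))" by simp
    then have "kappa n r \<le> 1 / real (r + 1)"
      using less.prems by (simp only: mult_le_cancel_left_pos of_nat_0_less_iff)
    then show ?thesis by (simp add: add.commute)
  qed
qed

section \<open>A contour integral for the error\<close>

definition truncated_log :: "nat \<Rightarrow> complex \<Rightarrow> complex" where
  "truncated_log r z = (\<Sum>j=1..r. z ^ j / of_nat j)"

text \<open>
  In the unit disc this is \<open>\<Sum> \<kappa>(n,r) z^n\<close>, the exponential of \<open>\<Sum> z^j / j\<close> over \<open>j > r\<close>. The form
  below continues it to all \<open>z \<noteq> 1\<close>; it will be used outside the disc, where the series diverges.
\<close>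

definition kappa_gf :: "nat \<Rightarrow> complex \<Rightarrow> complex" where
  "kappa_gf r z = exp (- truncated_log r z) / (1 - z)"

lemma has_field_derivative_truncated_log:
  "(truncated_log r has_field_derivative (\<Sum>i<r. z ^ i)) (at z)"
proof -
  have "((\<lambda>z. \<Sum>j=1..r. z ^ j / of_nat j) has_field_derivative (\<Sum>j=1..r. z ^ (j - 1))) (at z)"
    by (rule DERIV_sum) (auto intro!: derivative_eq_intros)
  also have "(\<Sum>j=1..r. z ^ (j - 1)) = (\<Sum>i<r. z ^ i)"
    by (rule sum.reindex_bij_witness[of _ Suc "\<lambda>j. j - 1"]) auto
  finally show ?thesis unfolding truncated_log_def [abs_def] .
qed

text \<open>
  The logarithmic derivative \<open>z^r / (1 - z)\<close> is the derivative of \<open>\<Sum> z^j / j\<close> over \<open>j > r\<close>.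
\<close>

lemma has_field_derivative_kappa_gf:
  assumes "z \<noteq> 1"
  shows "(kappa_gf r has_field_derivative z ^ r * kappa_gf r z / (1 - z)) (at z)"
proof -
  let ?Q = "exp (- truncated_log r z)" and ?S = "\<Sum>i<r. z ^ i"
  have "((\<lambda>z. exp (- truncated_log r z) / (1 - z)) has_field_derivative
      (- ?S * ?Q * (1 - z) + ?Q) / ((1 - z) * (1 - z))) (at z)"
    using assms by (auto intro!: derivative_eq_intros has_field_derivative_truncated_log)
  also have "- ?S * ?Q * (1 - z) + ?Q = ?Q * (1 - (1 - z) * ?S)"
    by (simp add: algebra_simps)
  also have "(1 - z) * ?S = 1 - z ^ r"
    by (simp add: one_diff_power_eq)
  finally show ?thesis
    unfolding kappa_gf_def [abs_def] by (simp add: field_simps)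
qed

lemma continuous_on_kappa_gf: "1 \<notin> S \<Longrightarrow> continuous_on S (kappa_gf r)"
  using has_field_derivative_kappa_gf DERIV_isCont
  by (metis continuous_at_imp_continuous_on)

text \<open>
  The integrals of \<open>kappa_gf r z * z^m\<close> over a circle of radius \<open>x > 1\<close> are determined by their
  values for \<open>m \<ge> -1\<close> and a recurrence that comes from the differential equation; this avoids
  power series and residues altogether. The integrals with the additional factor \<open>1 / (1 - z)\<close>
  serve as an intermediate quantity.
\<close>

context
  fixes x :: real and r :: nat
  assumes x: "x > 1"
begin

lemma circle_avoids: "0 \<notin> path_image (circlepath 0 x)" "1 \<notin> path_image (circlepath 0 x)"
  using x by auto

lemma integrable_powi:
  "(\<lambda>z. kappa_gf r z * z powi m) contour_integrable_on circlepath 0 x"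
  "(\<lambda>z. kappa_gf r z / (1 - z) * z powi m) contour_integrable_on circlepath 0 x"
  using x
  by (auto intro!: contour_integrable_continuous_circlepath continuous_intros continuous_on_kappa_gf)

abbreviation moment :: "int \<Rightarrow> complex" where
  "moment m \<equiv> contour_integral (circlepath 0 x) (\<lambda>z. kappa_gf r z * z powi m)"

abbreviation moment1 :: "int \<Rightarrow> complex" where
  "moment1 m \<equiv> contour_integral (circlepath 0 x) (\<lambda>z. kappa_gf r z / (1 - z) * z powi m)"

lemma circle_integral_derivative:
  assumes "\<And>z. z \<noteq> 0 \<Longrightarrow> z \<noteq> 1 \<Longrightarrow> (G has_field_derivative g z) (at z)"
  shows "(g has_contour_integral 0) (circlepath 0 x)"
  by (rule Cauchy_theorem_primitive[where S = "- {0, 1}" and f = G])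
     (use assms x in \<open>auto intro: DERIV_subset\<close>)

text \<open>
  The derivative of \<open>kappa_gf r z * z^k\<close> integrates to zero.
\<close>

lemma moment1_eq: "moment1 (int r + k) = - of_int k * moment (k - 1)"
proof -
  have "((\<lambda>z. of_int k * (kappa_gf r z * z powi (k - 1)) + kappa_gf r z / (1 - z) * z powi (int r + k))
          has_contour_integral 0) (circlepath 0 x)"
  proof (rule circle_integral_derivative)
    fix z :: complex assume z: "z \<noteq> 0" "z \<noteq> 1"
    have "((\<lambda>z. kappa_gf r z * z powi k) has_field_derivative
        z ^ r * kappa_gf r z / (1 - z) * z powi k + of_int k * z powi (k - 1) * 1 * kappa_gf r z) (at z)"
      using z by (intro DERIV_mult has_field_derivative_kappa_gf DERIV_power_int DERIV_ident) auto
    also have "z ^ r * kappa_gf r z / (1 - z) * z powi k + of_int k * z powi (k - 1) * 1 * kappa_gf r z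
      = of_int k * (kappa_gf r z * z powi (k - 1)) + kappa_gf r z / (1 - z) * z powi (int r + k)"
      using z by (simp add: power_int_add field_simps)
    finally show "((\<lambda>z. kappa_gf r z * z powi k) has_field_derivative
      of_int k * (kappa_gf r z * z powi (k - 1)) + kappa_gf r z / (1 - z) * z powi (int r + k)) (at z)" .
  qed
  moreover have "((\<lambda>z. of_int k * (kappa_gf r z * z powi (k - 1)) + kappa_gf r z / (1 - z) * z powi (int r + k))
          has_contour_integral of_int k * moment (k - 1) + moment1 (int r + k)) (circlepath 0 x)"
    by (intro has_contour_integral_add has_contour_integral_lmul has_contour_integral_integral
          integrable_powi)
  ultimately have "of_int k * moment (k - 1) + moment1 (int r + k) = 0"
    by (rule has_contour_integral_unique[rotated])
  then show ?thesis by (simp add: add_eq_0_iff)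
qed

lemma moment1_diff: "moment1 m - moment1 (m + 1) = moment m"
proof -
  have "((\<lambda>z. kappa_gf r z / (1 - z) * z powi m - kappa_gf r z / (1 - z) * z powi (m + 1))
     has_contour_integral moment1 m - moment1 (m + 1)) (circlepath 0 x)"
    by (intro has_contour_integral_diff has_contour_integral_integral integrable_powi)
  moreover have "kappa_gf r z / (1 - z) * z powi m - kappa_gf r z / (1 - z) * z powi (m + 1) =
      kappa_gf r z * z powi m" if "z \<in> path_image (circlepath 0 x)" for z
  proof -
    have z: "z \<noteq> 0" "z \<noteq> 1" using that circle_avoids by auto
    then have "kappa_gf r z / (1 - z) * z powi m - kappa_gf r z / (1 - z) * z powi (m + 1) =
       (1 - z) * (kappa_gf r z / (1 - z) * z powi m)"
    proof -
      have "a * p - a * (p * z) = (1 - z) * (a * p)" for a p :: complex by (simp add: algebra_simps)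
      moreover have "z powi (m + 1) = z powi m * z" using z by (simp add: power_int_add_1)
      ultimately show ?thesis by (simp only:)
    qed
    then show ?thesis using z by simp
  qed
  ultimately have "((\<lambda>z. kappa_gf r z * z powi m) has_contour_integral moment1 m - moment1 (m + 1)) (circlepath 0 x)"
    by (rule has_contour_integral_eq)
  then show ?thesis by (simp add: contour_integral_unique)
qed

lemma moment_rec: "of_nat (Suc n) * moment (- int (Suc n) - 1) = of_nat n * moment (- int n - 1) + moment (int r - int n - 1)"
  using moment1_diff[of "int r - int n - 1"] moment1_eq[of "- int n"] moment1_eq[of "- int (Suc n)"]
  by (simp add: algebra_simps)

lemma exp_truncated_log_1: "exp (- truncated_log r 1) = of_real (exp (- harm r))"
  by (simp add: truncated_log_def harm_def inverse_eq_divide flip: exp_of_real)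

text \<open>
  For these exponents the pole at 1 is the only one inside the circle.
\<close>

lemma moment_nonneg:
  "moment (int k) = - (2 * of_real pi * \<i> * of_real (exp (- harm r)))"
proof -
  have "continuous_on (cball 0 x) (\<lambda>z. - exp (- truncated_log r z) * z ^ k)"
       "(\<lambda>z. - exp (- truncated_log r z) * z ^ k) holomorphic_on ball 0 x"
    unfolding truncated_log_def by (auto intro!: continuous_intros holomorphic_intros)
  then have "((\<lambda>u. - exp (- truncated_log r u) * u ^ k / (u - 1)) has_contour_integral
      2 * of_real pi * \<i> * (- exp (- truncated_log r 1) * 1 ^ k)) (circlepath 0 x)"
    by (rule Cauchy_integral_circlepath) (use x in simp)
  moreover have "- exp (- truncated_log r u) * u ^ k / (u - 1) = kappa_gf r u * u powi int k"
    if "u \<in> path_image (circlepath 0 x)" for u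
  proof -
    have "u \<noteq> 1" using that circle_avoids by auto
    then show ?thesis by (simp add: kappa_gf_def field_simps)
  qed
  ultimately have "((\<lambda>z. kappa_gf r z * z powi int k) has_contour_integral
     2 * of_real pi * \<i> * (- exp (- truncated_log r 1) * 1 ^ k)) (circlepath 0 x)"
    by (rule has_contour_integral_eq)
  then show ?thesis by (simp add: contour_integral_unique exp_truncated_log_1)
qed

lemma moment_minus_1:
  "moment (-1) = 2 * of_real pi * \<i> * (1 - of_real (exp (- harm r)))"
proof -
  let ?Q = "\<lambda>z. exp (- truncated_log r z)"
  have Q: "continuous_on (cball 0 x) ?Q" "?Q holomorphic_on ball 0 x"
    unfolding truncated_log_def by (auto intro!: continuous_intros holomorphic_intros)
  have "((\<lambda>u. ?Q u / (u - 0)) has_contour_integral 2 * of_real pi * \<i> * ?Q 0) (circlepath 0 x)"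
       "((\<lambda>u. ?Q u / (u - 1)) has_contour_integral 2 * of_real pi * \<i> * ?Q 1) (circlepath 0 x)"
    using Q by (rule Cauchy_integral_circlepath; use x in simp)+
  then have "((\<lambda>u. ?Q u / (u - 0) - ?Q u / (u - 1)) has_contour_integral
        2 * of_real pi * \<i> * ?Q 0 - 2 * of_real pi * \<i> * ?Q 1) (circlepath 0 x)"
    by (rule has_contour_integral_diff)
  moreover have "?Q u / (u - 0) - ?Q u / (u - 1) = kappa_gf r u * u powi (-1)"
    if "u \<in> path_image (circlepath 0 x)" for u
  proof -
    have "u \<noteq> 1" "u \<noteq> 0" using that circle_avoids by auto
    then show ?thesis by (simp add: kappa_gf_def power_int_minus field_simps)
  qed
  ultimately have "((\<lambda>z. kappa_gf r z * z powi (-1)) has_contour_integral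
     2 * of_real pi * \<i> * ?Q 0 - 2 * of_real pi * \<i> * ?Q 1) (circlepath 0 x)"
    by (rule has_contour_integral_eq)
  moreover have "truncated_log r 0 = 0" unfolding truncated_log_def by (rule sum.neutral) auto
  then have "?Q 0 = 1" by simp
  ultimately show ?thesis
    by (simp add: contour_integral_unique exp_truncated_log_1 algebra_simps)
qed

text \<open>
  The moments with exponent \<open>- n - 1\<close> obey the recurrence of \<open>kappa\<close>. The moments with
  nonnegative exponent take the place of \<open>\<kappa>(n - r, r)\<close> for \<open>n < r\<close> and all equal the contribution
  of the pole at 1, so that it is \<open>\<kappa>(n,r) - exp (- harm r)\<close> which satisfies the common recurrence.
\<close>

lemma kappa_contour_integral:
  "moment (- int n - 1) = 2 * of_real pi * \<i> * of_real (kappa n r - exp (- harm r))"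
proof (induction n rule: less_induct)
  case (less n)
  show ?case
  proof (cases n)
    case 0
    then show ?thesis using moment_minus_1 kappa_0 by simp
  next
    case (Suc k)
    let ?c = "2 * of_real pi * \<i> :: complex"
    have "moment (int r - int k - 1) = ?c * of_real ((if r \<le> k then kappa (k - r) r else 0) - exp (- harm r))"
    proof (cases "r \<le> k")
      case True
      then have "int r - int k - 1 = - int (k - r) - 1" by simp
      then show ?thesis using less[of "k - r"] True Suc by simp
    next
      case False
      then have eq: "int r - int k - 1 = int (r - k - 1)" by simp
      show ?thesis unfolding eq moment_nonneg using False by simp
    qed
    then have "of_nat (Suc k) * moment (- int (Suc k) - 1) =
       of_nat k * (?c * of_real (kappa k r - exp (- harm r))) +
       ?c * of_real ((if r \<le> k then kappa (k - r) r else 0) - exp (- harm r))"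
      using less[of k] Suc by (simp only: moment_rec)
    also have "\<dots> = ?c * of_real (k * kappa k r + (if r \<le> k then kappa (k - r) r else 0) - real (Suc k) * exp (- harm r))"
      by (simp add: algebra_simps)
    also have "k * kappa k r + (if r \<le> k then kappa (k - r) r else 0) = real (Suc k) * kappa (Suc k) r"
      by (simp only: kappa_rec)
    also have "?c * of_real (real (Suc k) * kappa (Suc k) r - real (Suc k) * exp (- harm r)) =
       of_nat (Suc k) * (?c * of_real (kappa (Suc k) r - exp (- harm r)))"
      by (simp add: algebra_simps)
    finally show ?thesis unfolding Suc
      by (simp only: mult_cancel_left of_nat_eq_0_iff) simp
  qed
qed

text \<open>
  On the circle \<open>kappa_gf\<close> does not become small far away from \<open>z = 1\<close>, so that estimating
  the previous integral by absolute values would lose a factor \<open>r\<close>. Integrating by parts twice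
  (first \<open>z^{-n-1}\<close>, then \<open>z^{r-n}\<close>) brings in the weight \<open>1 / (1 - z)^2\<close>, whose mean over the circle
  is of order \<open>1 / (x - 1)\<close>, against a gain of \<open>n (n - r - 1)\<close>.
\<close>

lemma kappa_contour_integral_decaying:
  "((\<lambda>z. (1 + z ^ r) * kappa_gf r z / (1 - z)\<^sup>2 * z powi (int r + 1 - int n)) has_contour_integral
     2 * of_real pi * \<i> * of_real (real n * (real n - real r - 1) * (kappa n r - exp (- harm r)))) (circlepath 0 x)"
proof -
  define k where "k = int r + 1 - int n"
  let ?h = "\<lambda>z. (1 + z ^ r) * kappa_gf r z / (1 - z)\<^sup>2 * z powi k"
  have "((\<lambda>z. ?h z + of_int k * (kappa_gf r z / (1 - z) * z powi (k - 1)))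
          has_contour_integral 0) (circlepath 0 x)"
  proof (rule circle_integral_derivative)
    fix z :: complex assume z: "z \<noteq> 0" "z \<noteq> 1"
    have "((\<lambda>z. kappa_gf r z / (1 - z)) has_field_derivative (z ^ r * kappa_gf r z / (1 - z) * (1 - z)
         - kappa_gf r z * (-1)) / ((1 - z) * (1 - z))) (at z)"
      using z by (intro DERIV_divide has_field_derivative_kappa_gf) (auto intro!: derivative_eq_intros)
    also have "(z ^ r * kappa_gf r z / (1 - z) * (1 - z)
         - kappa_gf r z * (-1)) / ((1 - z) * (1 - z)) = (1 + z ^ r) * kappa_gf r z / (1 - z)\<^sup>2"
    proof -
      have "z ^ r * kappa_gf r z / (1 - z) * (1 - z) = z ^ r * kappa_gf r z" using z by simp
      then show ?thesis by (simp only: power2_eq_square) (simp add: algebra_simps)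
    qed
    finally have "((\<lambda>z. kappa_gf r z / (1 - z)) has_field_derivative (1 + z ^ r) * kappa_gf r z / (1 - z)\<^sup>2) (at z)" .
    then have "((\<lambda>z. (kappa_gf r z / (1 - z)) * z powi k) has_field_derivative
        (1 + z ^ r) * kappa_gf r z / (1 - z)\<^sup>2 * z powi k + of_int k * z powi (k - 1) * 1 * (kappa_gf r z / (1 - z))) (at z)"
      using z by (intro DERIV_mult DERIV_power_int DERIV_ident) auto
    then show "((\<lambda>z. (kappa_gf r z / (1 - z)) * z powi k) has_field_derivative
      ?h z + of_int k * (kappa_gf r z / (1 - z) * z powi (k - 1))) (at z)"
      by (simp add: mult_ac)
  qed
  moreover have "((\<lambda>z. of_int k * (kappa_gf r z / (1 - z) * z powi (k - 1)))
     has_contour_integral of_int k * moment1 (k - 1)) (circlepath 0 x)"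
    by (intro has_contour_integral_lmul has_contour_integral_integral integrable_powi)
  ultimately have "((\<lambda>z. ?h z + of_int k * (kappa_gf r z / (1 - z) * z powi (k - 1)) -
       of_int k * (kappa_gf r z / (1 - z) * z powi (k - 1))) has_contour_integral 0 - of_int k * moment1 (k - 1)) (circlepath 0 x)"
    by (rule has_contour_integral_diff)
  then have "(?h has_contour_integral - of_int k * moment1 (k - 1)) (circlepath 0 x)"
    by simp
  also have "k - 1 = int r + (- int n)" by (simp add: k_def)
  also have "- of_int k * moment1 (int r + (- int n)) =
    2 * of_real pi * \<i> * of_real (real n * (real n - real r - 1) * (kappa n r - exp (- harm r)))"
  proof -
    have "moment1 (int r + (- int n)) = of_nat n * moment (- int n - 1)"
      using moment1_eq[of "- int n"] by simp
    then show ?thesis by (simp only: kappa_contour_integral) (simp add: k_def algebra_simps)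
  qed
  finally show ?thesis by (simp add: k_def)
qed

text \<open>
  This is the total mass of the Poisson kernel. On the circle \<open>|1 - z|^2 = (1 - z) (1 - x^2 / z)\<close>,
  and Cauchy's formula applies to \<open>1 / (x^2 - z)\<close> at the point 1.
\<close>

lemma inverse_square_integral:
  "((\<lambda>t. 1 / (norm (1 - circlepath 0 x t))\<^sup>2) has_integral 1 / (x\<^sup>2 - 1)) {0..1}"
proof -
  have x2: "x\<^sup>2 > 1" using x by simp
  have xx: "x < x\<^sup>2" using x by (simp add: power2_eq_square)
  have nz: "complex_of_real (x\<^sup>2) - z \<noteq> 0" if "norm z \<le> x" for z
  proof
    assume "complex_of_real (x\<^sup>2) - z = 0"
    then have "norm z = x\<^sup>2" by (metis eq_iff_diff_eq_0 norm_of_real abs_power2 real_norm_def)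
    then show False using that xx by simp
  qed
  have "((\<lambda>z. 1 / (of_real (x\<^sup>2) - z) / (z - 1)) has_contour_integral
      2 * of_real pi * \<i> * (1 / (of_real (x\<^sup>2) - 1))) (circlepath 0 x)"
    by (rule Cauchy_integral_circlepath)
       (use nz x in \<open>auto intro!: continuous_intros holomorphic_intros simp del: of_real_power\<close>)
  then have "((\<lambda>t. 1 / (of_real (x\<^sup>2) - circlepath 0 x t) / (circlepath 0 x t - 1) *
     (2 * pi * \<i> * x * exp (2 * of_real pi * \<i> * t))) has_integral
      2 * of_real pi * \<i> * (1 / (of_real (x\<^sup>2) - 1))) {0..1}"
    by (simp add: has_contour_integral vector_derivative_circlepath del: of_real_power)
  then have "((\<lambda>t. (2 * of_real pi * \<i>) * of_real (1 / (norm (1 - circlepath 0 x t))\<^sup>2)) has_integral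
      2 * of_real pi * \<i> * of_real (1 / (x\<^sup>2 - 1))) {0..1}"
  proof (rule has_integral_eq[rotated, THEN has_integral_eq_rhs])
    fix t :: real assume "t \<in> {0..1}"
    define z where "z = circlepath 0 x t"
    have z: "z = x * exp (2 * of_real pi * \<i> * t)" by (simp add: z_def circlepath)
    have nz': "norm z = x" using x by (simp add: z norm_mult)
    have zz: "of_real (x\<^sup>2) = z * cnj z" using nz' by (simp add: complex_norm_square[symmetric])
    have z1: "z \<noteq> 1" "z \<noteq> 0" using nz' x by auto
    have "(of_real ((norm (1 - z))\<^sup>2) :: complex) = (1 - z) * cnj (1 - z)"
      by (rule complex_norm_square)
    also have "\<dots> = (1 - z) * (1 - cnj z)" by simp
    finally have n: "(of_real ((norm (1 - z))\<^sup>2) :: complex) = (1 - z) * (1 - cnj z)" .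
    have "1 - cnj z \<noteq> 0" using z1 by (metis complex_cnj_one_iff eq_iff_diff_eq_0)
    then have "1 / (z * cnj z - z) / (z - 1) * (2 * pi * \<i> * z) = (2 * of_real pi * \<i>) * (1 / ((1 - z) * (1 - cnj z)))"
      using z1 by (simp add: divide_simps) (simp add: algebra_simps)
    then show "1 / (of_real (x\<^sup>2) - circlepath 0 x t) / (circlepath 0 x t - 1) *
     (2 * pi * \<i> * x * exp (2 * of_real pi * \<i> * t)) = (2 * of_real pi * \<i>) * of_real (1 / (norm (1 - circlepath 0 x t))\<^sup>2)"
      unfolding z_def[symmetric] zz of_real_divide n by (simp add: z mult_ac)
  qed simp
  from has_integral_mult_right[OF this, of "inverse (2 * of_real pi * \<i>)"]
  have "((\<lambda>t. complex_of_real (1 / (norm (1 - circlepath 0 x t))\<^sup>2)) has_integral of_real (1 / (x\<^sup>2 - 1))) {0..1}"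
    by (simp add: field_simps)
  from has_integral_linear[OF this bounded_linear_Re] show ?thesis by (simp add: o_def)
qed

lemma norm_contour_integral_le:
  assumes f: "(f has_contour_integral I) (circlepath 0 x)"
    and B: "\<And>z. norm z = x \<Longrightarrow> norm (f z) \<le> B / (norm (1 - z))\<^sup>2"
  shows "norm I \<le> 2 * pi * x * B / (x\<^sup>2 - 1)"
proof -
  have g: "((\<lambda>t. 2 * pi * x * B * (1 / (norm (1 - circlepath 0 x t))\<^sup>2)) has_integral
      2 * pi * x * B * (1 / (x\<^sup>2 - 1))) {0..1}"
    by (intro has_integral_mult_right inverse_square_integral)
  have f': "((\<lambda>t. f (circlepath 0 x t) * vector_derivative (circlepath 0 x) (at t)) has_integral I) {0..1}"
    using f by (simp add: has_contour_integral)
  have "norm (integral {0..1} (\<lambda>t. f (circlepath 0 x t) * vector_derivative (circlepath 0 x) (at t))) \<le>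
     integral {0..1} (\<lambda>t. 2 * pi * x * B * (1 / (norm (1 - circlepath 0 x t))\<^sup>2))"
  proof (rule integral_norm_bound_integral)
    fix t :: real
    have n: "norm (circlepath 0 x t) = x" using x by (simp add: circlepath norm_mult)
    have "norm (vector_derivative (circlepath 0 x) (at t)) = 2 * pi * x"
      using x by (simp add: vector_derivative_circlepath norm_mult)
    then show "norm (f (circlepath 0 x t) * vector_derivative (circlepath 0 x) (at t)) \<le>
      2 * pi * x * B * (1 / (norm (1 - circlepath 0 x t))\<^sup>2)"
      using mult_right_mono[OF B[OF n], of "2 * pi * x"] x by (simp add: norm_mult field_simps)
  qed (use f' g in \<open>auto simp: has_integral_integrable\<close>)
  then show ?thesis using f' g by (simp add: integral_unique)
qed

lemma kappa_error_le_max: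
  assumes n: "n > r + 1" and M: "\<And>z. norm z = x \<Longrightarrow> norm (kappa_gf r z) \<le> M"
  shows "\<bar>kappa n r - exp (- harm r)\<bar> \<le>
     x ^ (r + 2) / x ^ n * (1 + x ^ r) * M / ((x\<^sup>2 - 1) * (real n * (real n - real r - 1)))"
proof -
  define d where "d = kappa n r - exp (- harm r)"
  define N where "N = real n * (real n - real r - 1)"
  define B where "B = x ^ (r + 1) / x ^ n * (1 + x ^ r) * M"
  have N: "N > 0" using n by (simp add: N_def)
  have "norm (2 * of_real pi * \<i> * complex_of_real (N * d)) \<le> 2 * pi * x * B / (x\<^sup>2 - 1)"
    unfolding N_def d_def
  proof (rule norm_contour_integral_le[OF kappa_contour_integral_decaying])
    fix z :: complex assume z: "norm z = x"
    have "norm (z powi (int r + 1 - int n)) = x ^ (r + 1) / x ^ n"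
      using x z by (simp add: norm_power_int power_int_diff power_int_add)
    moreover have "norm ((1 + z ^ r) * kappa_gf r z) \<le> (1 + x ^ r) * M"
    proof -
      have "norm (1 + z ^ r) \<le> 1 + x ^ r" using norm_triangle_ineq[of 1 "z ^ r"] z by (simp add: norm_power)
      then show ?thesis using M[OF z] x unfolding norm_mult by (intro mult_mono) auto
    qed
    ultimately show "norm ((1 + z ^ r) * kappa_gf r z / (1 - z)\<^sup>2 * z powi (int r + 1 - int n)) \<le> B / (norm (1 - z))\<^sup>2"
      using mult_right_mono[of "norm ((1 + z ^ r) * kappa_gf r z)" "(1 + x ^ r) * M" "x ^ (r + 1) / x ^ n / (norm (1 - z))\<^sup>2"] x
      by (simp add: B_def norm_mult norm_divide norm_power mult_ac)
  qed
  then have "2 * pi * (N * \<bar>d\<bar>) \<le> 2 * pi * (x * B / (x\<^sup>2 - 1))"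
    using N by (simp add: norm_mult abs_mult mult_ac)
  then have "N * \<bar>d\<bar> \<le> x * B / (x\<^sup>2 - 1)"
    by (subst (asm) mult_le_cancel_left_pos) auto
  then have "\<bar>d\<bar> \<le> x * B / (x\<^sup>2 - 1) / N"
    using N by (metis pos_le_divide_eq mult.commute)
  also have "\<dots> = x ^ (r + 2) / x ^ n * (1 + x ^ r) * M / ((x\<^sup>2 - 1) * N)"
    by (simp add: B_def mult_ac)
  finally show ?thesis unfolding d_def N_def .
qed

end

section \<open>The generating function on a circle\<close>

lemma Re_of_real_mult: "Re (of_real c * w) = c * Re w"
  by simp

text \<open>
  The truncated logarithm on the unit circle is compared with the full logarithm at radius
  \<open>y = e^{-1/r}\<close>: for \<open>j \<le> r\<close> the weights \<open>y^j\<close> differ from 1 by at most \<open>j/r\<close>, and the tail \<open>j > r\<close>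
  is dominated by a geometric series of sum at most 1.
\<close>

lemma sum_Re_powers_ge:
  fixes w :: complex
  assumes r: "r > 0" and w: "norm w = 1"
  defines "y \<equiv> exp (- 1 / real r)"
  shows "(\<Sum>j=1..r. Re (w ^ j) / j) \<ge> - ln (norm (1 - of_real y * w)) - 2"
proof -
  define f where "f j = y ^ j * Re (w ^ j) / j" for j
  have y: "0 < y" "y < 1" using r by (auto simp: y_def)
  have nyw: "norm (of_real y * w) < 1" using y w by (simp add: norm_mult)
  have ne: "1 - of_real y * w \<noteq> 0"
    using nyw by auto
  have "(\<lambda>n. (-1) ^ Suc n / of_nat n * (- (of_real y * w)) ^ n) sums ln (1 + (- (of_real y * w)))"
    by (rule Ln_series) (use nyw in simp)
  from sums_Re[OF this]
  have "(\<lambda>n. Re ((-1) ^ Suc n / of_nat n * (- (of_real y * w)) ^ n)) sums ln (norm (1 - of_real y * w))"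
    using ne by simp
  also have "(\<lambda>n. Re ((-1) ^ Suc n / of_nat n * (- (of_real y * w)) ^ n)) = (\<lambda>n. - f n)"
  proof
    fix n
    have "(-1) ^ Suc n / of_nat n * (- (of_real y * w)) ^ n =
        ((-1) ^ n * (-1) ^ n) * (- (of_real (y ^ n) * w ^ n / of_nat n))"
      by (simp add: power_minus[of "of_real y * w"] power_mult_distrib)
    also have "(-1) ^ n * (-1) ^ n = (1 :: complex)"
      by (simp flip: power_mult_distrib)
    finally have "(-1) ^ Suc n / of_nat n * (- (of_real y * w)) ^ n = - (of_real (y ^ n / n) * w ^ n)"
      by simp
    then show "Re ((-1) ^ Suc n / of_nat n * (- (of_real y * w)) ^ n) = - f n"
      by (simp only: uminus_complex.sel Re_of_real_mult f_def) simp
  qed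
  finally have f: "f sums (- ln (norm (1 - of_real y * w)))"
    using sums_minus by fastforce
  have Re_le: "\<bar>Re (w ^ j)\<bar> \<le> 1" for j
    using abs_Re_le_cmod[of "w ^ j"] w by (simp add: norm_power)
  have tail: "(\<Sum>n. f (n + Suc r)) \<le> 1"
  proof -
    have g: "(\<lambda>n. y ^ n * (y ^ Suc r / Suc r)) sums (1 / (1 - y) * (y ^ Suc r / Suc r))"
      by (intro sums_mult2 geometric_sums) (use y in auto)
    have le: "f (n + Suc r) \<le> y ^ n * (y ^ Suc r / Suc r)" for n
    proof -
      have "f (n + Suc r) \<le> y ^ (n + Suc r) * 1 / (n + Suc r)"
        unfolding f_def using Re_le[of "n + Suc r"] y by (intro divide_right_mono mult_left_mono) auto
      also have "\<dots> \<le> y ^ (n + Suc r) / Suc r"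
        using y by (simp only: mult_1_right) (intro divide_left_mono, auto)
      finally show ?thesis by (simp only: power_add times_divide_eq_right)
    qed
    have "summable (\<lambda>n. f (n + Suc r))"
      using sums_summable[OF f] by (rule summable_ignore_initial_segment)
    from sums_le[OF le summable_sums[OF this] g]
    have "(\<Sum>n. f (n + Suc r)) \<le> 1 / (1 - y) * (y ^ Suc r / Suc r)" .
    also have "1 / (1 - y) \<le> Suc r"
    proof -
      have "1 + 1 / r \<le> exp (1 / real r)" by (rule exp_ge_add_one_self)
      then have "y \<le> 1 / (1 + 1 / r)"
        unfolding y_def using r by (simp add: exp_minus field_simps)
      also have "\<dots> = 1 - 1 / Suc r" using r by (simp add: field_simps)
      finally have "1 / Suc r \<le> 1 - y" by simp
      then show ?thesis using y by (simp add: field_simps)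
    qed
    then have "1 / (1 - y) * (y ^ Suc r / Suc r) \<le> Suc r * (y ^ Suc r / Suc r)"
      using y by (intro mult_right_mono) auto
    also have "\<dots> = y ^ Suc r" by simp
    also have "\<dots> \<le> 1" using y by (intro power_le_one) auto
    finally show ?thesis .
  qed
  have "(\<Sum>j<Suc r. f j) = (\<Sum>j=1..r. f j)"
    by (rule sum.mono_neutral_right) (auto simp: f_def)
  also have "\<dots> \<le> (\<Sum>j=1..r. Re (w ^ j) / j + 1 / r)"
  proof (rule sum_mono)
    fix j assume j: "j \<in> {1..r}"
    have "y ^ j = exp (j * (- 1 / r))" by (simp only: y_def exp_of_nat_mult)
    moreover have "1 + j * (- 1 / r) \<le> exp (j * (- 1 / r))" by (rule exp_ge_add_one_self)
    ultimately have yj: "1 - y ^ j \<le> j / r" by simp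
    have yj0: "0 \<le> 1 - y ^ j" using y by (simp add: power_le_one)
    have "f j - Re (w ^ j) / j = (1 - y ^ j) * (- Re (w ^ j)) / j"
      using j by (simp add: f_def field_simps)
    also have "\<dots> \<le> (1 - y ^ j) * 1 / j"
      using Re_le[of j] yj0 by (intro divide_right_mono mult_left_mono) auto
    also have "\<dots> \<le> (j / r) / j" using yj j by (intro divide_right_mono) auto
    also have "\<dots> = 1 / r" using j by simp
    finally show "f j \<le> Re (w ^ j) / j + 1 / r" by simp
  qed
  also have "\<dots> = (\<Sum>j=1..r. Re (w ^ j) / j) + 1"
    using r by (simp add: sum.distrib)
  finally have "(\<Sum>j<Suc r. f j) \<le> (\<Sum>j=1..r. Re (w ^ j) / j) + 1" .
  moreover have "- ln (norm (1 - of_real y * w)) = (\<Sum>n. f (n + Suc r)) + (\<Sum>j<Suc r. f j)"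
    using f suminf_split_initial_segment[of f "Suc r"] by (simp add: sums_iff)
  ultimately show ?thesis using tail by linarith
qed

lemma norm_one_minus_scaled_le:
  fixes w :: complex
  assumes r: "r > 0" and w: "norm w = 1" and x: "1 / real r \<le> x - 1"
  shows "norm (1 - of_real (exp (- 1 / real r)) * w) \<le> 3 * norm (1 - of_real x * w)"
proof -
  define y where "y = exp (- 1 / real r)"
  have "0 < 1 / real r" using r by simp
  have "1 + (- 1 / real r) \<le> y" unfolding y_def by (rule exp_ge_add_one_self)
  then have y: "1 - y \<le> x - 1" "y \<le> 1" using x by (auto simp: y_def)
  have "norm (1 - of_real y * w) = norm ((1 - of_real x * w) + of_real (x - y) * w)"
    by (simp add: algebra_simps)
  also have "\<dots> \<le> norm (1 - of_real x * w) + norm (of_real (x - y) * w)" by (rule norm_triangle_ineq)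
  also have "norm (of_real (x - y) * w) = x - y"
    using w y x \<open>0 < 1 / real r\<close> by (simp only: norm_mult norm_of_real) simp
  also have "x - y \<le> 2 * (x - 1)" using y by simp
  also have "x - 1 \<le> norm (1 - of_real x * w)"
    using norm_triangle_ineq3[of "of_real x * w" 1] w x \<open>0 < 1 / real r\<close>
    by (simp add: norm_mult norm_minus_commute)
  finally show ?thesis by (simp add: y_def)
qed

text \<open>
  In \<open>x^j = 1 + (x^j - 1)\<close> the term 1 yields the truncated logarithm of the unit vector \<open>z / x\<close>.
  By the two preceding lemmas it is compensated by the denominator \<open>1 - z\<close>, so
  that only the terms \<open>x^j - 1\<close> remain, with no loss in \<open>r\<close>.
\<close>

lemma norm_kappa_gf_le_phases:
  fixes z :: complex and x :: real
  assumes r: "r > 0" and x: "1 / real r \<le> x - 1" and z: "norm z = x"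
  defines "w \<equiv> z / of_real x"
  shows "norm (kappa_gf r z) \<le> 3 * exp 2 * exp (- (\<Sum>j=1..r. (x ^ j - 1) / j * Re (w ^ j)))"
proof -
  have "0 < 1 / real r" using r by simp
  then have x1: "x > 1" using x by linarith
  have w: "norm w = 1" and zw: "z = of_real x * w" using z x1 by (auto simp: w_def norm_divide)
  define y where "y = exp (- 1 / real r)"
  let ?S = "\<Sum>j=1..r. (x ^ j - 1) / j * Re (w ^ j)"
  have z1: "norm (1 - z) > 0" using z x1 by auto
  have yw: "norm (1 - of_real y * w) > 0"
  proof -
    have "norm (of_real y * w) < 1" using w r by (simp add: norm_mult y_def)
    then show ?thesis by auto
  qed
  have "Re (truncated_log r z) = (\<Sum>j=1..r. x ^ j * Re (w ^ j) / j)"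
    unfolding truncated_log_def Re_sum
  proof (rule sum.cong)
    fix j
    have "z ^ j / of_nat j = of_real (x ^ j / j) * w ^ j" by (simp add: zw power_mult_distrib)
    then show "Re (z ^ j / of_nat j) = x ^ j * Re (w ^ j) / j"
      by (simp only: Re_of_real_mult) simp
  qed simp
  also have "\<dots> = ?S + (\<Sum>j=1..r. Re (w ^ j) / j)"
    by (simp add: sum.distrib[symmetric] field_simps)
  finally have "- Re (truncated_log r z) \<le> - ?S + ln (norm (1 - of_real y * w)) + 2"
    using sum_Re_powers_ge[OF r w] by (simp add: y_def)
  then have "exp (- Re (truncated_log r z)) \<le> exp (- ?S + ln (norm (1 - of_real y * w)) + 2)"
    by simp
  also have "\<dots> = exp 2 * exp (- ?S) * norm (1 - of_real y * w)"
    using yw by (simp only: exp_add exp_ln mult_ac)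
  also have "\<dots> \<le> exp 2 * exp (- ?S) * (3 * norm (1 - z))"
    unfolding y_def zw by (intro mult_left_mono norm_one_minus_scaled_le r w x) auto
  finally show ?thesis
    using z1 by (simp add: kappa_gf_def norm_divide divide_le_eq mult_ac)
qed

lemma norm_scaled_minus_one_squared:
  fixes w :: complex
  assumes "norm w = 1"
  shows "(norm (of_real x * w - 1))\<^sup>2 = (x - 1)\<^sup>2 + x * (norm (w - 1))\<^sup>2"
proof -
  have "(Re w)\<^sup>2 + (Im w)\<^sup>2 = 1" using assms by (simp add: cmod_power2[symmetric])
  then have im: "(Im w)\<^sup>2 = 1 - (Re w)\<^sup>2" by simp
  show ?thesis by (simp add: cmod_power2 power_mult_distrib im) (simp add: power2_eq_square algebra_simps)
qed

text \<open>
  If \<open>w\<close> is within \<open>1/r\<close> of 1, then \<open>Re (w^j) \<ge> 0\<close> for all \<open>j \<le> r\<close> and the whole sum of the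
  \<open>(x^j - 1) / j\<close> is saved. Otherwise \<open>1/j\<close> is replaced by \<open>1/r\<close>, and with \<open>z = x w\<close> the geometric
  sum \<open>\<Sum> z^j\<close> is, up to O(r), smaller than \<open>\<Sum> x^j\<close> by the factor \<open>(x - 1) / |z - 1|\<close>, where
  \<open>|z - 1|^2 \<ge> (x - 1)^2 + x / r^2\<close>. For \<open>x = e^{s/r}\<close> with \<open>s/r\<close> small, \<open>\<eta>\<close> is about
  \<open>1 / (2 (1 + s^2))\<close>.
\<close>

lemma phase_saving:
  fixes w :: complex and x :: real
  assumes r: "r > 0" and x: "1 / real r \<le> x - 1" and w: "norm w = 1"
  defines "N \<equiv> \<Sum>j=1..r. x ^ j"
    and "\<eta> \<equiv> x / (2 * ((real r)\<^sup>2 * (x - 1)\<^sup>2 + x))"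
  shows "(\<Sum>j=1..r. (x ^ j - 1) / j * (1 + Re (w ^ j))) \<ge> N / r * \<eta> - 6"
proof -
  have r0: "0 < 1 / real r" using r by simp
  then have x1: "x > 1" using x by linarith
  have N0: "N \<ge> 0" unfolding N_def using x1 by (intro sum_nonneg) auto
  have \<eta>: "0 \<le> \<eta>" "\<eta> \<le> 1 / 2"
  proof -
    show "0 \<le> \<eta>" using x1 by (auto simp: \<eta>_def)
    have "\<eta> \<le> x / (2 * x)"
      unfolding \<eta>_def using x1 by (intro divide_left_mono) (auto intro!: mult_pos_pos add_nonneg_pos)
    then show "\<eta> \<le> 1 / 2" using x1 by simp
  qed
  have Re_ge: "-1 \<le> Re (w ^ j)" "Re (w ^ j) \<le> 1" for j
    using abs_Re_le_cmod[of "w ^ j"] w by (auto simp: norm_power)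
  have xj: "0 \<le> x ^ j - 1" for j using x1 by simp
  have step: "(\<Sum>j=1..r. (x ^ j - 1) / j * (1 + Re (w ^ j))) \<ge> (\<Sum>j=1..r. (x ^ j - 1) / r * (1 + Re (w ^ j)))"
  proof (rule sum_mono)
    fix j assume "j \<in> {1..r}"
    then show "(x ^ j - 1) / r * (1 + Re (w ^ j)) \<le> (x ^ j - 1) / j * (1 + Re (w ^ j))"
      using xj[of j] Re_ge(1)[of j] by (intro mult_right_mono divide_left_mono) auto
  qed
  show ?thesis
  proof (cases "norm (w - 1) < 1 / r")
    case True
    have "(\<Sum>j=1..r. (x ^ j - 1) / r) \<le> (\<Sum>j=1..r. (x ^ j - 1) / r * (1 + Re (w ^ j)))"
    proof (rule sum_mono)
      fix j assume j: "j \<in> {1..r}"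
      have "norm (w ^ j - 1 ^ j) \<le> j * norm (w - 1)"
        using w by (intro norm_power_diff) auto
      also have "\<dots> \<le> r * norm (w - 1)" using j by (intro mult_right_mono) auto
      also have "\<dots> \<le> 1" using True r by (simp add: field_simps)
      finally have "\<bar>Re (w ^ j - 1)\<bar> \<le> 1" using abs_Re_le_cmod[of "w ^ j - 1"] by simp
      then have "0 \<le> Re (w ^ j)" by simp
      then show "(x ^ j - 1) / r \<le> (x ^ j - 1) / r * (1 + Re (w ^ j))"
        using mult_left_mono[of 1 "1 + Re (w ^ j)" "(x ^ j - 1) / r"] xj[of j] by simp
    qed
    moreover have "(\<Sum>j=1..r. (x ^ j - 1) / r) = N / r - 1"
      using r by (simp add: N_def sum_divide_distrib[symmetric] sum_subtractf diff_divide_distrib)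
    moreover have "N / r * \<eta> \<le> N / r * 1" using \<eta> N0 by (intro mult_left_mono) auto
    ultimately show ?thesis using step by linarith
  next
    case False
    define z where "z = of_real x * w"
    define R where "R = norm (z - 1)"
    have Rx: "x - 1 \<le> R"
      using norm_triangle_ineq2[of z 1] w x1 by (simp add: R_def z_def norm_mult)
    then have R0: "R > 0" using x1 by linarith
    have "(x - 1)\<^sup>2 + x * (1 / r)\<^sup>2 \<le> R\<^sup>2"
      unfolding R_def z_def norm_scaled_minus_one_squared[OF w] using False x1
      by (intro add_left_mono mult_left_mono power_mono) auto
    then have "(x - 1) / R \<le> 1 - \<eta>"
    proof -
      assume a: "(x - 1)\<^sup>2 + x * (1 / r)\<^sup>2 \<le> R\<^sup>2"
      have "0 < (x - 1)\<^sup>2 + x * (1 / r)\<^sup>2"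
        using x1 r by (intro add_pos_pos mult_pos_pos zero_less_power) auto
      then have "((x - 1) / R)\<^sup>2 \<le> (x - 1)\<^sup>2 / ((x - 1)\<^sup>2 + x * (1 / r)\<^sup>2)"
        using a R0 unfolding power_divide[of "x - 1" R]
        by (intro divide_left_mono mult_pos_pos zero_less_power) simp_all
      also have "\<dots> = 1 - 2 * \<eta>"
      proof -
        have "(real r)\<^sup>2 * (x - 1)\<^sup>2 + x > 0" using x1 by (intro add_nonneg_pos) auto
        moreover have "(x - 1)\<^sup>2 + x * (1 / r)\<^sup>2 = ((real r)\<^sup>2 * (x - 1)\<^sup>2 + x) / (real r)\<^sup>2"
          using r by (simp add: field_simps)
        ultimately show ?thesis using r unfolding \<eta>_def by (simp add: field_simps)
      qed
      also have "\<dots> \<le> (1 - \<eta>)\<^sup>2"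
      proof -
        have "(1 - \<eta>)\<^sup>2 = 1 - 2 * \<eta> + \<eta>\<^sup>2" by (simp only: power2_diff) simp
        then show ?thesis using zero_le_power2[of \<eta>] by linarith
      qed
      finally have sq: "((x - 1) / R)\<^sup>2 \<le> (1 - \<eta>)\<^sup>2" .
      have "0 \<le> 1 - \<eta>" using \<eta>(2) by linarith
      with sq show ?thesis by (rule power2_le_imp_le)
    qed
    then have Rle: "(x - 1) / R \<le> 1 - \<eta>" .
    have "(1 - z) * (\<Sum>j=1..r. z ^ j) = z * ((1 - z) * (\<Sum>i<r. z ^ i))"
    proof -
      have "(\<Sum>j=1..r. z ^ j) = (\<Sum>i<r. z ^ Suc i)"
        by (rule sum.reindex_bij_witness[of _ Suc "\<lambda>j. j - 1"]) auto
      then show ?thesis by (simp add: sum_distrib_left mult_ac)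
    qed
    also have "(1 - z) * (\<Sum>i<r. z ^ i) = 1 - z ^ r" by (simp add: one_diff_power_eq)
    finally have "norm ((1 - z) * (\<Sum>j=1..r. z ^ j)) = norm (z * (1 - z ^ r))" by (rule arg_cong)
    then have "R * norm (\<Sum>j=1..r. z ^ j) = norm z * norm (1 - z ^ r)"
      by (simp add: norm_mult R_def norm_minus_commute)
    also have "\<dots> \<le> x * (1 + x ^ r)"
      using norm_triangle_ineq4[of 1 "z ^ r"] x1 w
      by (intro mult_mono) (auto simp: z_def norm_mult norm_power)
    also have "\<dots> = (x - 1) * N + 2 * x"
    proof -
      have "N = (\<Sum>i<r. x * x ^ i)" unfolding N_def
        by (rule sum.reindex_bij_witness[of _ Suc "\<lambda>j. j - 1"]) (auto simp: power_eq_if)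
      then have "(1 - x) * N = x * ((1 - x) * (\<Sum>i<r. x ^ i))"
        by (simp add: sum_distrib_left[symmetric])
      also have "(1 - x) * (\<Sum>i<r. x ^ i) = 1 - x ^ r" by (simp add: one_diff_power_eq)
      finally show ?thesis by (simp add: algebra_simps)
    qed
    finally have "norm (\<Sum>j=1..r. z ^ j) \<le> ((x - 1) * N + 2 * x) / R"
      using R0 by (simp only: pos_le_divide_eq mult.commute)
    also have "\<dots> = (x - 1) / R * N + 2 * x / R"
      by (simp add: add_divide_distrib)
    also have "\<dots> \<le> (1 - \<eta>) * N + 2 * x / (x - 1)"
      using Rle Rx N0 x1 by (intro add_mono mult_right_mono divide_left_mono) auto
    also have "2 * x / (x - 1) \<le> 4 * r"
    proof -
      have "1 / (x - 1) \<le> r" using x x1 r by (simp add: field_simps)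
      moreover have "x / (x - 1) = 1 + 1 / (x - 1)" using x1 by (simp add: field_simps)
      moreover have "1 \<le> real r" using r by simp
      ultimately have "2 * (x / (x - 1)) \<le> 4 * real r" by linarith
      then show ?thesis by simp
    qed
    finally have geom: "- ((1 - \<eta>) * N + 4 * r) \<le> Re (\<Sum>j=1..r. z ^ j)"
      using abs_Re_le_cmod[of "\<Sum>j=1..r. z ^ j"] by linarith
    have "(\<Sum>j=1..r. (x ^ j - 1) * (1 + Re (w ^ j))) = N + Re (\<Sum>j=1..r. z ^ j) - (\<Sum>j=1..r. 1 + Re (w ^ j))"
    proof -
      have "Re (z ^ j) = x ^ j * Re (w ^ j)" for j
        unfolding z_def power_mult_distrib of_real_power[symmetric] by (rule Re_of_real_mult)
      then show ?thesis unfolding N_def Re_sum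
        by (simp add: sum.distrib[symmetric] sum_subtractf[symmetric] algebra_simps)
    qed
    moreover have "(\<Sum>j=1..r. 1 + Re (w ^ j)) \<le> (\<Sum>j=1..r. 2)"
    proof (rule sum_mono)
      fix j show "1 + Re (w ^ j) \<le> 2" using Re_ge(2)[of j] by linarith
    qed
    moreover have "(\<Sum>j=1..r. 2 :: real) = 2 * r" by simp
    moreover have "(1 - \<eta>) * N = N - \<eta> * N" by (simp add: left_diff_distrib)
    ultimately have "\<eta> * N - 6 * r \<le> (\<Sum>j=1..r. (x ^ j - 1) * (1 + Re (w ^ j)))"
      using geom by linarith
    then have "(\<eta> * N - 6 * r) / r \<le> (\<Sum>j=1..r. (x ^ j - 1) * (1 + Re (w ^ j))) / r"
      by (intro divide_right_mono) auto
    also have "\<dots> = (\<Sum>j=1..r. (x ^ j - 1) / r * (1 + Re (w ^ j)))"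
      by (simp only: sum_divide_distrib times_divide_eq_left)
    also have "\<dots> \<le> (\<Sum>j=1..r. (x ^ j - 1) / j * (1 + Re (w ^ j)))" by (rule step)
    finally show ?thesis using r by (simp add: diff_divide_distrib mult.commute)
  qed
qed

lemma norm_kappa_gf_le:
  fixes z :: complex and x :: real
  assumes r: "r > 0" and x: "1 / real r \<le> x - 1" and z: "norm z = x"
  shows "norm (kappa_gf r z) \<le> 3 * exp 8 * exp ((\<Sum>j=1..r. (x ^ j - 1) / j) -
     (\<Sum>j=1..r. x ^ j) / r * (x / (2 * ((real r)\<^sup>2 * (x - 1)\<^sup>2 + x))))"
    (is "_ \<le> _ * exp (?T - ?D)")
proof -
  define w where "w = z / of_real x"
  have "0 < 1 / real r" using r by simp
  then have "x > 1" using x by linarith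
  then have w: "norm w = 1" using z by (simp add: w_def norm_divide)
  have "(\<Sum>j=1..r. (x ^ j - 1) / j * (1 + Re (w ^ j))) = ?T + (\<Sum>j=1..r. (x ^ j - 1) / j * Re (w ^ j))"
    by (simp only: distrib_left mult_1_right sum.distrib)
  then have "- (\<Sum>j=1..r. (x ^ j - 1) / j * Re (w ^ j)) \<le> ?T - ?D + 6"
    using phase_saving[OF r x w] by simp
  then have "3 * exp 2 * exp (- (\<Sum>j=1..r. (x ^ j - 1) / j * Re (w ^ j))) \<le> 3 * exp 2 * exp (?T - ?D + 6)"
    by simp
  also have "\<dots> = 3 * exp 8 * exp (?T - ?D)" by (simp add: exp_add[symmetric])
  finally show ?thesis using norm_kappa_gf_le_phases[OF r x z] by (simp add: w_def)
qed

section \<open>The exponent at the saddle point\<close>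

definition expm1_ratio :: "real \<Rightarrow> real" where
  "expm1_ratio s = (exp s - 1) / s"

text \<open>
  An entire exponential integral up to an additive constant; starting at 1 keeps the removable
  singularity of the integrand at 0 out of the way.
\<close>

definition ein :: "real \<Rightarrow> real" where
  "ein s = integral {1..s} expm1_ratio"

lemma expm1_ratio_less:
  assumes "0 < a" "a < b"
  shows "expm1_ratio a < expm1_ratio b"
  unfolding expm1_ratio_def
proof (rule DERIV_pos_imp_increasing[OF assms(2)])
  fix s assume "a \<le> s" "s \<le> b"
  then have s: "s > 0" using assms by simp
  have "((\<lambda>s. (exp s - 1) / s) has_real_derivative (exp s * s - (exp s - 1)) / (s * s)) (at s)"
    using s by (auto intro!: derivative_eq_intros)
  moreover have "(exp s * s - (exp s - 1)) / (s * s) > 0"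
  proof -
    have "1 - s < exp (- s)" using exp_minus_greater[of s] s by simp
    then have "exp s * (1 - s) < exp s * exp (- s)" by simp
    then have "exp s * s - (exp s - 1) > 0" by (simp add: exp_minus algebra_simps)
    then show ?thesis using s by (intro divide_pos_pos) auto
  qed
  ultimately show "\<exists>y. ((\<lambda>s. (exp s - 1) / s) has_real_derivative y) (at s) \<and> y > 0"
    by blast
qed

lemma expm1_ratio_le_iff:
  "0 < a \<Longrightarrow> 0 < b \<Longrightarrow> expm1_ratio a \<le> expm1_ratio b \<longleftrightarrow> a \<le> b"
  by (metis expm1_ratio_less linorder_not_le order_le_less)

lemma continuous_on_expm1_ratio: "0 \<notin> A \<Longrightarrow> continuous_on A expm1_ratio"
  unfolding expm1_ratio_def [abs_def] by (auto intro!: continuous_intros)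

lemma expm1_ratio_integrable: "0 < a \<Longrightarrow> expm1_ratio integrable_on {a..b}"
  by (intro integrable_continuous_real continuous_on_expm1_ratio) auto

lemma ein_diff: "1 \<le> a \<Longrightarrow> a \<le> b \<Longrightarrow> ein b - ein a = integral {a..b} expm1_ratio"
  using Henstock_Kurzweil_Integration.integral_combine[of 1 a b expm1_ratio] expm1_ratio_integrable[of 1 b]
  by (simp add: ein_def)

text \<open>
  Convexity of \<open>ein\<close>, whose derivative increases.
\<close>

lemma ein_tangent:
  assumes "1 \<le> a" "1 \<le> b"
  shows "ein b - ein a \<ge> expm1_ratio a * (b - a)"
proof (cases "a \<le> b")
  case True
  have "integral {a..b} (\<lambda>_. expm1_ratio a) \<le> integral {a..b} expm1_ratio"
    by (rule integral_le) (use assms expm1_ratio_integrable in \<open>auto simp: expm1_ratio_le_iff\<close>)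
  then show ?thesis using ein_diff[OF assms(1) True] True by (simp add: mult.commute)
next
  case False
  have "integral {b..a} expm1_ratio \<le> integral {b..a} (\<lambda>_. expm1_ratio a)"
    by (rule integral_le) (use assms expm1_ratio_integrable in \<open>auto simp: expm1_ratio_le_iff\<close>)
  then have "ein a - ein b \<le> (a - b) * expm1_ratio a"
    using ein_diff[OF assms(2), of a] False by (simp add: mult.commute)
  then show ?thesis by (simp add: algebra_simps)
qed

lemma has_real_derivative_ein:
  assumes "s > 1" shows "(ein has_real_derivative expm1_ratio s) (at s)"
proof -
  have "((\<lambda>x. integral {1..x} expm1_ratio) has_real_derivative expm1_ratio s) (at s within {1..s + 1})"
    by (rule integral_has_real_derivative) (use assms continuous_on_expm1_ratio in auto)
  moreover have "at s within {1..s + 1} = at s"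
    using assms by (intro at_within_interior) (auto simp: interior_atLeastAtMost_real)
  ultimately show ?thesis by (simp add: ein_def [abs_def])
qed

lemma continuous_on_ein: "continuous_on {1..b} ein"
  unfolding ein_def [abs_def]
  by (intro indefinite_integral_continuous_1 expm1_ratio_integrable) simp

text \<open>
  The Taylor expansion of the left-hand side starts with \<open>1 + y / 2 + y^2 / 12\<close>. With \<open>y = \<xi>(u) / r\<close>
  and \<open>\<xi>(u) \<le> 1.1 ln u\<close>, any slope up to \<open>1 / 1.1\<close> lets \<open>u^{u/r}\<close> cover the discretisation error.
\<close>

lemma bernoulli_quotient_le:
  fixes y :: real
  assumes "0 < y" "y \<le> 2"
  shows "y / (1 - exp (- y)) \<le> 1 + 3 / 4 * y"
proof -
  have q: "1 + y + y\<^sup>2 / 2 \<le> exp y" using assms by (intro exp_lower_Taylor_quadratic) auto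
  have "(1 + 3/4 * y) \<le> (1 - y / 4) * (1 + y + y\<^sup>2 / 2)"
  proof -
    have "(1 - y / 4) * (1 + y + y\<^sup>2 / 2) - (1 + 3/4 * y) = y\<^sup>2 / 8 * (2 - y)"
      by (simp add: power2_eq_square field_simps)
    moreover have "y\<^sup>2 / 8 * (2 - y) \<ge> 0" using assms by (intro mult_nonneg_nonneg) auto
    ultimately show ?thesis by linarith
  qed
  also have "\<dots> \<le> (1 - y / 4) * exp y" using assms q by (intro mult_left_mono) auto
  finally have "(1 + 3/4 * y) * exp (- y) \<le> (1 - y / 4) * exp y * exp (- y)"
    by (intro mult_right_mono) auto
  also have "(1 - y / 4) * exp y * exp (- y) = 1 - y / 4"
    by (simp add: mult.assoc exp_minus)
  finally have "(1 + 3/4 * y) * exp (- y) \<le> 1 - y / 4" .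
  moreover have "(1 + 3/4 * y) * (1 - exp (- y)) = 1 + 3/4 * y - (1 + 3/4 * y) * exp (- y)"
    by (simp only: right_diff_distrib mult_1_right)
  ultimately have "y \<le> (1 + 3/4 * y) * (1 - exp (- y))" by linarith
  moreover have "exp (- y) < 1" using assms by simp
  ultimately show ?thesis by (simp add: divide_le_eq)
qed

lemma sum_exp_mean:
  assumes r: "r > 0" and s: "s > 0"
  shows "(\<Sum>j=1..r. exp (s / real r) ^ j) / r = expm1_ratio s * ((s / r) / (1 - exp (- (s / r))))"
proof -
  define x where "x = exp (s / real r)"
  have x1: "x > 1" using assms by (simp add: x_def)
  have "(\<Sum>j=1..r. x ^ j) = (\<Sum>i<r. x * x ^ i)"
    by (rule sum.reindex_bij_witness[of _ Suc "\<lambda>j. j - 1"]) (auto simp: power_eq_if)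
  then have "(1 - x) * (\<Sum>j=1..r. x ^ j) = x * ((1 - x) * (\<Sum>i<r. x ^ i))"
    by (simp add: sum_distrib_left[symmetric])
  also have "(1 - x) * (\<Sum>i<r. x ^ i) = 1 - x ^ r" by (simp add: one_diff_power_eq)
  also have "x ^ r = exp s" using r by (simp add: x_def flip: exp_of_nat_mult)
  finally have "(x - 1) * (\<Sum>j=1..r. x ^ j) = x * (exp s - 1)" by (simp add: algebra_simps)
  then have "(\<Sum>j=1..r. x ^ j) = (exp s - 1) * (x / (x - 1))" using x1 by (simp add: field_simps)
  also have "x / (x - 1) = 1 / (1 - exp (- (s / r)))"
    using x1 by (simp add: x_def exp_minus field_simps)
  finally show ?thesis using r s by (simp add: expm1_ratio_def x_def)
qed

lemma sum_exp_mean_ge: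
  assumes r: "r > 0" and s: "s > 0"
  shows "expm1_ratio s \<le> (\<Sum>j=1..r. exp (s / real r) ^ j) / r"
proof -
  define y where "y = s / r"
  have y: "0 < y" using assms by (simp add: y_def)
  have "1 + (- y) \<le> exp (- y)" by (rule exp_ge_add_one_self)
  then have "1 \<le> y / (1 - exp (- y))" using y by (simp add: pos_le_divide_eq)
  moreover have "0 \<le> expm1_ratio s" using s by (simp add: expm1_ratio_def)
  ultimately show ?thesis unfolding sum_exp_mean[OF assms]
    using mult_left_mono[of 1 "y / (1 - exp (- y))" "expm1_ratio s"] by (simp add: y_def)
qed

text \<open>
  As functions of \<open>s\<close>, the derivatives of the two sides are the mean of the \<open>x^j\<close> and
  \<open>(e^s - 1) / s\<close>, plus a correction. The quotient of these two is the one bounded in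
  \<open>bernoulli_quotient_le\<close> at \<open>y = s/r\<close>.
\<close>

lemma sum_expm1_le_ein:
  assumes r: "r > 0" and s: "1 \<le> s" "s \<le> 2 * r"
  shows "(\<Sum>j=1..r. (exp (s / real r) ^ j - 1) / j) \<le> 2 + ein s + 3 / 4 * exp s / r"
proof -
  define T where "T t = (\<Sum>j=1..r. (exp (t * (j / real r)) - 1) / j)" for t
  define h where "h t = T t - ein t - 3 / 4 * exp t / r" for t
  have "h s \<le> h 1"
  proof (cases "s = 1")
    case False
    show ?thesis
    proof (rule DERIV_nonpos_imp_decreasing_open[of 1 s])
      fix t assume t: "1 < t" "t < s"
      have "(T has_real_derivative (\<Sum>j=1..r. exp (t / r) ^ j / r)) (at t)"
        unfolding T_def
      proof (rule DERIV_sum)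
        fix j assume j: "j \<in> {1..r}"
        have "exp (t / r) ^ j = exp (t * (j / r))" by (simp add: mult.commute flip: exp_of_nat_mult)
        then show "((\<lambda>t. (exp (t * (j / real r)) - 1) / j) has_real_derivative exp (t / r) ^ j / r) (at t)"
          using j by (auto intro!: derivative_eq_intros simp: field_simps)
      qed
      then have "(h has_real_derivative (\<Sum>j=1..r. exp (t / r) ^ j / r) - expm1_ratio t - 3 / 4 * exp t / r) (at t)"
        unfolding h_def using t r
        by (auto intro!: derivative_eq_intros has_real_derivative_ein)
      moreover have "(\<Sum>j=1..r. exp (t / r) ^ j / r) \<le> expm1_ratio t + 3 / 4 * exp t / r"
      proof -
        have e: "expm1_ratio t \<ge> 0" using t by (simp add: expm1_ratio_def)
        have "(\<Sum>j=1..r. exp (t / r) ^ j / r) = expm1_ratio t * ((t / r) / (1 - exp (- (t / r))))"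
          using sum_exp_mean[OF r, of t] t by (simp add: sum_divide_distrib)
        also have "\<dots> \<le> expm1_ratio t * (1 + 3 / 4 * (t / r))"
          using t s r e by (intro mult_left_mono bernoulli_quotient_le) (auto simp: divide_le_eq)
        also have "\<dots> = expm1_ratio t + 3 / 4 * (exp t - 1) / r"
          using t by (simp add: expm1_ratio_def field_simps)
        also have "\<dots> \<le> expm1_ratio t + 3 / 4 * exp t / r"
          by (intro add_left_mono divide_right_mono) auto
        finally show ?thesis .
      qed
      ultimately show "\<exists>y. (h has_real_derivative y) (at t) \<and> y \<le> 0"
        by (intro exI conjI) auto
    next
      show "continuous_on {1..s} h"
        unfolding h_def [abs_def] T_def [abs_def] by (intro continuous_intros continuous_on_ein) (use r in auto)
    qed (use False s in auto)
  qed simp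
  also have "h 1 \<le> 2"
  proof -
    have "T 1 \<le> (\<Sum>j=1..r. 2 / r)"
      unfolding T_def
    proof (rule sum_mono)
      fix j assume j: "j \<in> {1..r}"
      define y where "y = j / real r"
      have y: "0 < y" "y \<le> 1" using j r by (auto simp: y_def)
      have "exp y \<le> 1 + y + y\<^sup>2" using y by (intro exp_bound) auto
      also have "y\<^sup>2 \<le> y" using y by (simp add: power2_eq_square)
      finally have "(exp y - 1) / j \<le> (2 * y) / j" by (intro divide_right_mono) auto
      also have "\<dots> = 2 / r" using j by (simp add: y_def)
      finally show "(exp (1 * (j / real r)) - 1) / j \<le> 2 / r" by (simp add: y_def)
    qed
    also have "\<dots> = 2" using r by simp
    finally have "T 1 \<le> 2" .
    moreover have "0 \<le> 3 / 4 * exp 1 / real r" by simp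
    moreover have "ein 1 = 0" by (simp add: ein_def)
    ultimately show ?thesis unfolding h_def by linarith
  qed
  finally have "T s \<le> 2 + ein s + 3 / 4 * exp s / r" by (simp add: h_def)
  moreover have "T s = (\<Sum>j=1..r. (exp (s / real r) ^ j - 1) / j)"
    unfolding T_def by (intro sum.cong) (auto simp: mult.commute simp flip: exp_of_nat_mult)
  ultimately show ?thesis by simp
qed

text \<open>
  The left-hand side is \<open>e^y (2 sinh (y / 2))^2\<close>, so for small \<open>y\<close> a constant near 1 would do; any
  constant below about \<open>1.96\<close> is good enough for the final comparison.
\<close>

lemma expm1_squared_le:
  fixes y :: real
  assumes "0 \<le> y" "y \<le> 6 / 5"
  shows "(exp y - 1)\<^sup>2 \<le> 17 / 10 * y\<^sup>2 * exp y"
proof -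
  define t where "t = y / 2"
  have t: "0 \<le> t" "t \<le> 3 / 5" using assms by (auto simp: t_def)
  have "exp t \<le> 1 + t + t\<^sup>2" using t by (intro exp_bound) auto
  also have "t\<^sup>2 \<le> 3 / 5 * t" using mult_right_mono[OF t(2) t(1)] by (simp add: power2_eq_square)
  finally have "exp t - exp (- t) \<le> 13 / 10 * y"
    using exp_ge_add_one_self[of "- t"] by (simp add: t_def)
  moreover have "0 \<le> exp t - exp (- t)" using t by simp
  ultimately have "(exp t - exp (- t))\<^sup>2 \<le> (13 / 10 * y)\<^sup>2" by (intro power_mono) auto
  also have "\<dots> \<le> 17 / 10 * y\<^sup>2" by (simp add: power2_eq_square)
  finally have "exp y * (exp t - exp (- t))\<^sup>2 \<le> exp y * (17 / 10 * y\<^sup>2)" by (intro mult_left_mono) auto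
  moreover have "exp y - 1 = exp t * (exp t - exp (- t))"
    by (simp add: right_diff_distrib t_def flip: exp_add)
  then have "(exp y - 1)\<^sup>2 = exp y * (exp t - exp (- t))\<^sup>2"
    by (simp add: power_mult_distrib t_def flip: exp_double)
  ultimately show ?thesis by (simp add: mult_ac)
qed

section \<open>A lower bound for the Dickman function\<close>

definition xi :: "real \<Rightarrow> real" where
  "xi u = (SOME s. 1 \<le> s \<and> s \<le> 2 * u \<and> expm1_ratio s = u)"

lemma xi:
  assumes "u \<ge> 2"
  shows "1 \<le> xi u" "xi u \<le> 2 * u" "expm1_ratio (xi u) = u"
proof -
  have "expm1_ratio 1 \<le> u"
    using exp_le assms by (simp add: expm1_ratio_def)
  moreover have "u \<le> expm1_ratio (2 * u)"
  proof -
    have "1 + 2 * u + (2 * u)\<^sup>2 / 2 \<le> exp (2 * u)" using assms by (intro exp_lower_Taylor_quadratic) auto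
    moreover have "u * (2 * u) = (2 * u)\<^sup>2 / 2" by (simp add: power2_eq_square)
    ultimately have "u * (2 * u) \<le> exp (2 * u) - 1" using assms by linarith
    then show ?thesis using assms by (simp add: expm1_ratio_def pos_le_divide_eq)
  qed
  ultimately have "\<exists>s\<ge>1. s \<le> 2 * u \<and> expm1_ratio s = u"
    by (intro IVT' continuous_on_expm1_ratio) (use assms in auto)
  then have "1 \<le> xi u \<and> xi u \<le> 2 * u \<and> expm1_ratio (xi u) = u"
    unfolding xi_def by (intro someI_ex[of "\<lambda>s. 1 \<le> s \<and> s \<le> 2 * u \<and> expm1_ratio s = u"]) blast
  then show "1 \<le> xi u" "xi u \<le> 2 * u" "expm1_ratio (xi u) = u" by auto
qed

lemma exp_xi: "u \<ge> 2 \<Longrightarrow> exp (xi u) = 1 + u * xi u"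
  using xi[of u] by (auto simp: expm1_ratio_def field_simps)

lemma xi_le_iff: "u \<ge> 2 \<Longrightarrow> 0 < s \<Longrightarrow> xi u \<le> s \<longleftrightarrow> u \<le> expm1_ratio s"
  using xi[of u] expm1_ratio_le_iff[of "xi u" s] by auto

lemma xi_mono: "2 \<le> u \<Longrightarrow> u \<le> v \<Longrightarrow> xi u \<le> xi v"
  using xi_le_iff[of u "xi v"] xi[of v] by auto

text \<open>
  The Legendre transform of \<open>ein\<close>, that is, the maximum of \<open>u s - ein s\<close> over \<open>s\<close>.
\<close>

definition legendre_ein :: "real \<Rightarrow> real" where
  "legendre_ein u = u * xi u - ein (xi u)"

text \<open>
  The slope of the convex function \<open>legendre_ein\<close> at \<open>u\<close> is the maximiser \<open>xi u\<close>; no derivative of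
  \<open>xi\<close> is involved.
\<close>

lemma legendre_ein_tangent:
  assumes "u \<ge> 2" "v \<ge> 2"
  shows "legendre_ein v - legendre_ein u \<ge> (v - u) * xi u"
  using ein_tangent[OF xi(1) xi(1), OF assms(2,1)] xi(3)[OF assms(2)]
  by (simp add: legendre_ein_def algebra_simps)

lemma legendre_ein_mono:
  assumes "2 \<le> u" "u \<le> v"
  shows "legendre_ein u \<le> legendre_ein v"
proof -
  have "0 \<le> (v - u) * xi u" using assms xi(1)[of u] by simp
  then show ?thesis using legendre_ein_tangent[of u v] assms by simp
qed

lemma continuous_on_legendre_ein: "continuous_on {2..b} legendre_ein"
proof (cases "2 \<le> b")
  case True
  have *: "\<bar>legendre_ein v - legendre_ein u\<bar> \<le> 2 * b * \<bar>v - u\<bar>"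
    if "2 \<le> u" "u \<le> v" "v \<le> b" for u v
  proof -
    have "legendre_ein u - legendre_ein v \<ge> (u - v) * xi v"
      using legendre_ein_tangent[of v u] that by simp
    then have "legendre_ein v - legendre_ein u \<le> (v - u) * xi v" by (simp add: algebra_simps)
    also have "\<dots> \<le> (v - u) * (2 * b)" using xi(2)[of v] that by (intro mult_left_mono) auto
    finally show ?thesis using legendre_ein_mono[of u v] that by (simp add: mult_ac)
  qed
  have "(2 * b)-lipschitz_on {2..b} legendre_ein"
  proof (rule lipschitz_onI)
    fix u v assume uv: "u \<in> {2..b}" "v \<in> {2..b}"
    show "dist (legendre_ein u) (legendre_ein v) \<le> 2 * b * dist u v"
      using *[of u v] *[of v u] uv by (cases "u \<le> v") (auto simp: dist_real_def abs_minus_commute)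
  qed (use True in auto)
  then show ?thesis by (rule lipschitz_on_continuous_on)
qed simp

lemma legendre_ein_shift_le: "u \<ge> 2 \<Longrightarrow> legendre_ein (u + 2) \<le> legendre_ein u + 2 * xi (u + 2)"
  using legendre_ein_tangent[of "u + 2" u] by simp

text \<open>
  The function \<open>e^{-L}\<close> itself satisfies the averaging inequality with the factor \<open>u - 1\<close> instead of
  \<open>u\<close>. Each shift of the argument by 1 raises this factor by 1, and a shift by 2 makes it exceed
  \<open>u\<close>, at the cost of a power of \<open>u\<close>.
\<close>

definition dickman_minorant :: "real \<Rightarrow> real" where
  "dickman_minorant t = exp (- legendre_ein (t + 2))"

lemma continuous_on_dickman_minorant: "continuous_on {0..b} dickman_minorant"
  unfolding dickman_minorant_def [abs_def]
  by (intro continuous_intros continuous_on_compose2[OF continuous_on_legendre_ein[of "b + 2"]]) auto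

text \<open>
  By convexity \<open>e^{-L}\<close> grows to the left of \<open>u + 2\<close> at least as fast as the exponential with rate
  \<open>\<xi>(u + 1)\<close>, the slope at the left end of the interval, and the integral of that exponential over a
  unit interval is \<open>u + 1\<close> by the definition of \<open>\<xi>\<close>.
\<close>

lemma dickman_minorant_subsolution:
  assumes u: "u \<ge> 1"
  shows "(u + 1) * dickman_minorant u \<le> integral {u - 1..u} dickman_minorant"
proof -
  define s where "s = xi (u + 1)"
  have s: "s \<ge> 1" "expm1_ratio s = u + 1" using xi[of "u + 1"] u by (auto simp: s_def)
  have "((\<lambda>t. dickman_minorant u * exp (s * (u - t))) has_integral
      - dickman_minorant u * exp (s * (u - u)) / s - (- dickman_minorant u * exp (s * (u - (u - 1))) / s)) {u - 1..u}"
  proof (rule fundamental_theorem_of_calculus)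
    fix t assume "t \<in> {u - 1..u}"
    show "((\<lambda>t. - dickman_minorant u * exp (s * (u - t)) / s) has_vector_derivative
      dickman_minorant u * exp (s * (u - t))) (at t within {u - 1..u})"
      unfolding has_real_derivative_iff_has_vector_derivative[symmetric]
      using s by (auto intro!: derivative_eq_intros)
  qed simp
  also have "- dickman_minorant u * exp (s * (u - u)) / s - (- dickman_minorant u * exp (s * (u - (u - 1))) / s) =
      dickman_minorant u * expm1_ratio s"
    using s by (simp add: expm1_ratio_def field_simps)
  finally have i: "((\<lambda>t. dickman_minorant u * exp (s * (u - t))) has_integral dickman_minorant u * (u + 1)) {u - 1..u}"
    by (simp only: s(2))
  have "integral {u - 1..u} (\<lambda>t. dickman_minorant u * exp (s * (u - t))) \<le> integral {u - 1..u} dickman_minorant"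
  proof (rule integral_le)
    show "dickman_minorant integrable_on {u - 1..u}"
      using u by (intro integrable_continuous_real continuous_on_subset[OF continuous_on_dickman_minorant[of u]]) auto
    fix t assume t: "t \<in> {u - 1..u}"
    have "s * (u - t) \<le> (u - t) * xi (t + 2)"
      using t u xi_mono[of "u + 1" "t + 2"] unfolding s_def mult.commute[of _ "u - t"]
      by (intro mult_left_mono) auto
    also have "\<dots> \<le> legendre_ein (u + 2) - legendre_ein (t + 2)"
      using legendre_ein_tangent[of "t + 2" "u + 2"] t u by simp
    finally show "dickman_minorant u * exp (s * (u - t)) \<le> dickman_minorant t"
      by (simp add: dickman_minorant_def flip: exp_add)
  qed (use i in \<open>auto simp: has_integral_integrable\<close>)
  then show ?thesis by (simp only: integral_unique[OF i] mult.commute)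
qed

lemma
  shows continuous_on_dickman: "continuous_on {0..} dickman"
    and dickman_eq_1: "0 \<le> v \<Longrightarrow> v \<le> 1 \<Longrightarrow> dickman v = 1"
    and has_real_derivative_dickman: "v > 1 \<Longrightarrow> (dickman has_real_derivative - dickman (v - 1) / v) (at v)"
proof -
  show "continuous_on {0..} dickman" "0 \<le> v \<Longrightarrow> v \<le> 1 \<Longrightarrow> dickman v = 1"
    using is_dickman_dickman by (auto simp: is_dickman_def)
  assume v: "v > 1"
  then have "dickman differentiable (at v)" and e: "v * deriv dickman v + dickman (v - 1) = 0"
    using is_dickman_dickman by (auto simp: is_dickman_def)
  then have "(dickman has_real_derivative deriv dickman v) (at v)"
    by (simp add: DERIV_deriv_iff_real_differentiable)
  moreover have "deriv dickman v = - dickman (v - 1) / v" using e v by (simp add: field_simps)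
  ultimately show "(dickman has_real_derivative - dickman (v - 1) / v) (at v)" by simp
qed

lemma dickman_integrable: "0 \<le> a \<Longrightarrow> dickman integrable_on {a..b}"
  by (intro integrable_continuous_real continuous_on_subset[OF continuous_on_dickman]) auto

text \<open>
  The delay equation says that the difference of the two sides is constant.
\<close>

lemma dickman_average:
  assumes "u \<ge> 1"
  shows "u * dickman u = integral {u - 1..u} dickman"
proof -
  define P where "P v = integral {0..v} dickman" for v
  define h where "h v = v * dickman v - P v + P (v - 1)" for v
  have P_cont: "continuous_on {0..b} P" for b
    unfolding P_def [abs_def] by (intro indefinite_integral_continuous_1 dickman_integrable) simp
  have P_deriv: "(P has_real_derivative dickman v) (at v)" if "v > 0" for v
  proof -
    have "(P has_real_derivative dickman v) (at v within {0..v + 1})"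
      unfolding P_def [abs_def]
      by (rule integral_has_real_derivative) (use that continuous_on_subset[OF continuous_on_dickman] in auto)
    moreover have "at v within {0..v + 1} = at v"
      using that by (intro at_within_interior) (auto simp: interior_atLeastAtMost_real)
    ultimately show ?thesis by simp
  qed
  have "h u = h 1"
  proof (cases "u = 1")
    case False
    show ?thesis
    proof (rule DERIV_isconst2[where f = h and a = 1 and b = u and x = u])
      show "continuous_on {1..u} h"
        unfolding h_def [abs_def]
        by (intro continuous_intros continuous_on_subset[OF continuous_on_dickman]
              continuous_on_subset[OF P_cont[of u]] continuous_on_compose2[OF P_cont[of u]]) auto
      fix v assume v: "1 < v" "v < u"
      have "((\<lambda>v. P (v - 1)) has_real_derivative dickman (v - 1) * 1) (at v)"
        using v by (intro DERIV_chain2[OF P_deriv]) (auto intro!: derivative_eq_intros)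
      then have "(h has_real_derivative (1 * dickman v + - dickman (v - 1) / v * v) - dickman v + dickman (v - 1) * 1) (at v)"
        unfolding h_def using v
        by (intro DERIV_add DERIV_diff DERIV_mult DERIV_ident has_real_derivative_dickman P_deriv) auto
      then show "(h has_real_derivative 0) (at v)" using v by simp
    qed (use False assms in auto)
  qed simp
  also have "h 1 = 0"
  proof -
    have "P 1 = integral {0..1::real} (\<lambda>_. 1 :: real)"
      unfolding P_def by (rule Henstock_Kurzweil_Integration.integral_cong) (simp add: dickman_eq_1)
    then show ?thesis by (simp add: h_def dickman_eq_1 P_def)
  qed
  finally have "u * dickman u = P u - P (u - 1)" by (simp add: h_def)
  also have "\<dots> = integral {u - 1..u} dickman"
    using Henstock_Kurzweil_Integration.integral_combine[of 0 "u - 1" u dickman] dickman_integrable[of 0 u] assms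
    by (simp add: P_def)
  finally show ?thesis .
qed

text \<open>
  At the first point where \<open>\<rho>\<close> meets the multiple of the minorant, averaging over the preceding
  unit interval would make \<open>\<rho>\<close> strictly larger.
\<close>

lemma dickman_ge_minorant:
  assumes "u \<ge> 0"
  shows "dickman u \<ge> exp (legendre_ein 2) / 2 * dickman_minorant u"
proof (rule ccontr)
  define c where "c = exp (legendre_ein 2) / 2"
  define f where "f t = dickman t - c * dickman_minorant t" for t
  define S where "S = {0..u} \<inter> f -` {..0}"
  have c: "c > 0" by (simp add: c_def)
  have pos: "dickman_minorant t > 0" for t by (simp add: dickman_minorant_def)
  have f_cont: "continuous_on {0..b} f" for b
    unfolding f_def [abs_def]
    by (intro continuous_intros continuous_on_subset[OF continuous_on_dickman] continuous_on_dickman_minorant) auto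
  assume "\<not> dickman u \<ge> exp (legendre_ein 2) / 2 * dickman_minorant u"
  then have "u \<in> S" using assms by (simp add: S_def f_def c_def)
  have "closed S" unfolding S_def
    by (rule continuous_closed_preimage[OF f_cont]) auto
  define m where "m = Inf S"
  have bdd: "bdd_below S" by (rule bdd_belowI[of _ 0]) (auto simp: S_def)
  have m: "m \<in> S" unfolding m_def
    using closed_contains_Inf[of S] \<open>u \<in> S\<close> \<open>closed S\<close> bdd by blast
  then have m0: "0 \<le> m" "m \<le> u" "f m \<le> 0" by (auto simp: S_def)
  (* m is the first point at which f is not positive *)
  have before: "f t > 0" if "0 \<le> t" "t < m" for t
  proof (rule ccontr)
    assume "\<not> f t > 0"
    then have "t \<in> S" using that m0 by (auto simp: S_def)
    then have "m \<le> t" unfolding m_def using bdd by (rule cInf_lower)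
    then show False using that by simp
  qed
  have m1: "m > 1"
  proof (rule ccontr)
    assume "\<not> m > 1"
    then have "dickman m = 1" using m0 by (intro dickman_eq_1) auto
    moreover have "dickman_minorant m \<le> exp (- legendre_ein 2)"
      unfolding dickman_minorant_def using m0 legendre_ein_mono[of 2 "m + 2"] by simp
    then have "c * dickman_minorant m \<le> c * exp (- legendre_ein 2)" using c by simp
    moreover have "c * exp (- legendre_ein 2) = 1 / 2" by (simp add: c_def exp_minus)
    ultimately show False using m0 by (simp add: f_def)
  qed
  have "f m \<ge> 0"
  proof (rule continuous_ge_on_closure[of "{m - 1..<m}" f m 0])
    show "continuous_on (closure {m - 1..<m}) f"
      using m1 by (intro continuous_on_subset[OF f_cont[of m]]) auto
  qed (use before m1 in \<open>auto intro: less_imp_le\<close>)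
  then have ge: "c * dickman_minorant t \<le> dickman t" if "t \<in> {m - 1..m}" for t
    using before[of t] that m1 by (cases "t = m") (auto simp: f_def)
  have "c * ((m + 1) * dickman_minorant m) \<le> c * integral {m - 1..m} dickman_minorant"
    using c m1 by (intro mult_left_mono dickman_minorant_subsolution) auto
  also have "\<dots> = integral {m - 1..m} (\<lambda>t. c * dickman_minorant t)" by simp
  also have "\<dots> \<le> integral {m - 1..m} dickman"
    using m1 ge
    by (intro integral_le dickman_integrable integrable_continuous_real continuous_intros
          continuous_on_subset[OF continuous_on_dickman_minorant[of m]]) auto
  also have "\<dots> = m * dickman m" using dickman_average[of m] m1 by simp
  also have "\<dots> \<le> m * (c * dickman_minorant m)" using m0 by (intro mult_left_mono) (auto simp: f_def)
  finally have "c * dickman_minorant m \<le> 0" by (simp add: algebra_simps)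
  then show False using c pos[of m] by (simp add: mult_le_0_iff)
qed

section \<open>Assembling the estimates\<close>

lemma exp_diff_conv_mult: "exp (a - b) = exp a * exp (- b :: real)"
  by (simp flip: exp_add)

lemma dickman_ge_legendre_ein:
  assumes "u \<ge> 2"
  shows "exp (- legendre_ein u) \<le> 2 * exp (- legendre_ein 2) * (1 + 2 * (u + 2)\<^sup>2)\<^sup>2 * dickman u"
proof -
  define X where "X = 1 + 2 * (u + 2)\<^sup>2"
  have "exp (xi (u + 2)) \<le> X"
  proof -
    have "(u + 2) * xi (u + 2) \<le> (u + 2) * (2 * (u + 2))"
      using assms xi(2)[of "u + 2"] by (intro mult_left_mono) auto
    then show ?thesis using exp_xi[of "u + 2"] assms by (simp add: X_def power2_eq_square mult_ac)
  qed
  then have "(exp (xi (u + 2)))\<^sup>2 \<le> X\<^sup>2" by (intro power_mono) auto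
  then have X: "exp (2 * xi (u + 2)) \<le> X\<^sup>2" by (simp add: exp_double)
  have d: "exp (legendre_ein 2) / 2 * dickman_minorant u \<le> dickman u"
    using assms by (intro dickman_ge_minorant) auto
  have "exp (- legendre_ein u) \<le> exp (- legendre_ein (u + 2) + 2 * xi (u + 2))"
    using legendre_ein_shift_le[OF assms] by simp
  also have "\<dots> = dickman_minorant u * exp (2 * xi (u + 2))"
    unfolding dickman_minorant_def by (simp only: exp_add)
  also have "\<dots> \<le> dickman_minorant u * X\<^sup>2"
    using X by (intro mult_left_mono) (auto simp: dickman_minorant_def)
  also have "dickman_minorant u = 2 * exp (- legendre_ein 2) * (exp (legendre_ein 2) / 2 * dickman_minorant u)"
    by (simp add: exp_minus)
  also have "\<dots> * X\<^sup>2 \<le> (2 * exp (- legendre_ein 2) * dickman u) * X\<^sup>2"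
    using d by (intro mult_right_mono mult_left_mono) auto
  finally show ?thesis by (simp add: X_def mult_ac)
qed

lemma dickman_pos: "u \<ge> 0 \<Longrightarrow> dickman u > 0"
  using dickman_ge_minorant[of u] by (rule order.strict_trans2[rotated]) (auto simp: dickman_minorant_def)

lemma dickman_bounded_below:
  "\<exists>c>0. \<forall>u\<in>{0..b}. c \<le> dickman u"
proof (intro exI conjI ballI)
  let ?c = "exp (legendre_ein 2) / 2 * exp (- legendre_ein (b + 2))"
  show "?c > 0" by simp
  fix u assume u: "u \<in> {0..b}"
  then have "exp (- legendre_ein (b + 2)) \<le> dickman_minorant u"
    using legendre_ein_mono[of "u + 2" "b + 2"] by (simp add: dickman_minorant_def)
  then have "?c \<le> exp (legendre_ein 2) / 2 * dickman_minorant u" by (intro mult_left_mono) auto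
  also have "\<dots> \<le> dickman u" using u by (intro dickman_ge_minorant) auto
  finally show "?c \<le> dickman u" .
qed

text \<open>
  The choice \<open>x = e^{s/r}\<close> with \<open>s = \<xi>(u)\<close> turns \<open>x^{-n} exp (ein s)\<close> into \<open>exp (- legendre_ein u)\<close>.
\<close>

lemma kappa_error_le_saddle:
  fixes n r :: nat and u :: real
  assumes r: "r \<ge> 1" and u: "real n = u * r" "u \<ge> 4" and small: "xi u \<le> 6 / 5 * r"
  shows "\<bar>kappa n r - exp (- harm r)\<bar> \<le>
     3 * exp 14 * (1 + 2 * u\<^sup>2)\<^sup>2 / r * exp (- legendre_ein u + 3 / 4 * u * xi u / r - u / (2 * (1 + 17 / 10 * (xi u)\<^sup>2)))"
proof -
  define s where "s = xi u"
  (* the radius of the circle and, in M, the bound for the generating function on it *)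
  define x where "x = exp (s / r)"
  define M where "M = 3 * exp 8 * exp (3 + ein s + 3 / 4 * u * s / r - u / (2 * (1 + 17 / 10 * s\<^sup>2)))"
  have s: "1 \<le> s" "s \<le> 2 * u" "expm1_ratio s = u" "exp s = 1 + u * s" "s \<le> 6 / 5 * r"
    using xi[of u] exp_xi[of u] u small by (auto simp: s_def)
  have rr: "1 \<le> real r" "r > 0" using r by auto
  have "1 + s / r \<le> x" unfolding x_def by (rule exp_ge_add_one_self)
  then have xs: "s / r \<le> x - 1" by linarith
  moreover have "1 / r \<le> s / r" using s rr by (intro divide_right_mono) auto
  ultimately have x1: "1 / r \<le> x - 1" by linarith
  moreover have "0 < 1 / real r" using rr by simp
  ultimately have x: "x > 1" by linarith
  have xr: "x ^ r = exp s" using rr by (simp add: x_def flip: exp_of_nat_mult)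
  have xn: "x ^ n = exp (u * s)"
    using rr u by (simp add: x_def flip: exp_of_nat_mult)
  have x2: "x\<^sup>2 \<le> exp 3"
  proof -
    have "x\<^sup>2 = exp (2 * (s / r))" by (simp only: x_def exp_double)
    also have "\<dots> \<le> exp 3" using s rr by (simp add: divide_le_eq)
    finally show ?thesis .
  qed
  have M: "norm (kappa_gf r z) \<le> M" if "norm z = x" for z
  proof -
    define N where "N = (\<Sum>j=1..r. x ^ j) / r"
    define \<eta> where "\<eta> = x / (2 * ((real r)\<^sup>2 * (x - 1)\<^sup>2 + x))"
    have "norm (kappa_gf r z) \<le> 3 * exp 8 * exp ((\<Sum>j=1..r. (x ^ j - 1) / j) - N * \<eta>)"
      unfolding N_def \<eta>_def by (rule norm_kappa_gf_le[OF rr(2) x1 that])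
    also have "(\<Sum>j=1..r. (x ^ j - 1) / j) - N * \<eta> \<le> 3 + ein s + 3 / 4 * u * s / r - u / (2 * (1 + 17 / 10 * s\<^sup>2))"
    proof -
      have "(\<Sum>j=1..r. (x ^ j - 1) / j) \<le> 2 + ein s + 3 / 4 * exp s / r"
        unfolding x_def by (rule sum_expm1_le_ein) (use rr s in auto)
      also have "3 / 4 * exp s / r = 3 / 4 / r + 3 / 4 * u * s / r"
        by (simp add: s(4) algebra_simps add_divide_distrib)
      also have "3 / 4 / r \<le> 1" using rr by (simp add: divide_le_eq)
      finally have T: "(\<Sum>j=1..r. (x ^ j - 1) / j) \<le> 3 + ein s + 3 / 4 * u * s / r" by simp
      have "u \<le> N" using sum_exp_mean_ge[OF rr(2), of s] s by (simp add: N_def x_def)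
      moreover have "1 / (2 * (1 + 17 / 10 * s\<^sup>2)) \<le> \<eta>"
      proof -
        have "(x - 1)\<^sup>2 \<le> 17 / 10 * (s / r)\<^sup>2 * x"
          unfolding x_def by (rule expm1_squared_le) (use s rr in \<open>auto simp: divide_le_eq\<close>)
        then have "(real r)\<^sup>2 * (x - 1)\<^sup>2 \<le> (real r)\<^sup>2 * (17 / 10 * (s / r)\<^sup>2 * x)"
          by (intro mult_left_mono) auto
        also have "\<dots> = 17 / 10 * s\<^sup>2 * x" using rr by (simp add: power_divide)
        finally have "2 * ((real r)\<^sup>2 * (x - 1)\<^sup>2 + x) \<le> x * (2 * (1 + 17 / 10 * s\<^sup>2))"
          by (simp add: algebra_simps)
        then have "x / (x * (2 * (1 + 17 / 10 * s\<^sup>2))) \<le> \<eta>"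
          unfolding \<eta>_def using x rr by (intro divide_left_mono) (auto intro!: mult_pos_pos add_nonneg_pos add_pos_nonneg)
        then show ?thesis using x by simp
      qed
      ultimately have "u * (1 / (2 * (1 + 17 / 10 * s\<^sup>2))) \<le> N * \<eta>"
        using u by (intro mult_mono) auto
      then show ?thesis using T by simp
    qed
    finally show ?thesis by (simp add: M_def)
  qed
  have M0: "M \<ge> 0" by (simp add: M_def)
  have n: "real n \<ge> 4 * r" using u rr by (simp add: mult_right_mono)
  then have "n > r + 1" using rr by linarith
  from kappa_error_le_max[OF x this M]
  have "\<bar>kappa n r - exp (- harm r)\<bar> \<le>
     x ^ (r + 2) / x ^ n * (1 + x ^ r) * M / ((x\<^sup>2 - 1) * (real n * (real n - real r - 1)))" .
  also have "\<dots> \<le> (exp 3 * exp s * exp (- (u * s))) * (2 * exp s) * M / (2 / r * (real r * real r))"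
  proof (rule frac_le)
    have "x ^ (r + 2) / x ^ n = x\<^sup>2 * exp s * exp (- (u * s))"
      by (simp add: power_add xr xn exp_minus field_simps power2_eq_square)
    also have "\<dots> \<le> exp 3 * exp s * exp (- (u * s))"
      using x2 by (intro mult_right_mono) auto
    finally have 1: "x ^ (r + 2) / x ^ n \<le> exp 3 * exp s * exp (- (u * s))" .
    have 2: "1 + x ^ r \<le> 2 * exp s" using s by (simp add: xr)
    show "x ^ (r + 2) / x ^ n * (1 + x ^ r) * M \<le> (exp 3 * exp s * exp (- (u * s))) * (2 * exp s) * M"
      using 1 2 M0 x by (intro mult_right_mono mult_mono) auto
    have "2 / r \<le> x\<^sup>2 - 1"
    proof -
      have "x\<^sup>2 - 1 = (x - 1) * (x + 1)" by (simp add: power2_eq_square algebra_simps)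
      moreover have "1 / r * 2 \<le> (x - 1) * (x + 1)" using x1 x by (intro mult_mono) auto
      ultimately show ?thesis by simp
    qed
    moreover have "real r * real r \<le> real n * (real n - real r - 1)"
      using n rr by (intro mult_mono) auto
    ultimately show "2 / r * (real r * real r) \<le> (x\<^sup>2 - 1) * (real n * (real n - real r - 1))"
      by (rule mult_mono) (use x in auto)
  qed (use M0 rr in auto)
  also have "\<dots> = exp 3 * (exp s)\<^sup>2 * exp (- (u * s)) * M / r"
    using rr by (simp add: field_simps power2_eq_square)
  also have "\<dots> \<le> exp 3 * (1 + 2 * u\<^sup>2)\<^sup>2 * exp (- (u * s)) * M / r"
  proof -
    have "u * s \<le> u * (2 * u)" using s u by (intro mult_left_mono) auto
    then have "exp s \<le> 1 + 2 * u\<^sup>2" by (simp add: s(4) power2_eq_square)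
    then show ?thesis using M0
      by (intro divide_right_mono mult_right_mono mult_left_mono power_mono) auto
  qed
  also have "\<dots> = 3 * exp 14 * (1 + 2 * u\<^sup>2)\<^sup>2 / r *
      exp (- legendre_ein u + 3 / 4 * u * s / r - u / (2 * (1 + 17 / 10 * s\<^sup>2)))"
  proof -
    have "exp 3 * exp (- (u * s)) * M = 3 * exp 14 * exp (- legendre_ein u + 3 / 4 * u * s / r - u / (2 * (1 + 17 / 10 * s\<^sup>2)))"
    proof -
      have "3 + (- (u * s)) + 8 + (3 + ein s + 3 / 4 * u * s / r - u / (2 * (1 + 17 / 10 * s\<^sup>2))) =
        14 + (- legendre_ein u + 3 / 4 * u * s / r - u / (2 * (1 + 17 / 10 * s\<^sup>2)))"
        by (simp add: legendre_ein_def s_def)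
      then have "exp (3 + (- (u * s)) + 8 + (3 + ein s + 3 / 4 * u * s / r - u / (2 * (1 + 17 / 10 * s\<^sup>2)))) =
        exp (14 + (- legendre_ein u + 3 / 4 * u * s / r - u / (2 * (1 + 17 / 10 * s\<^sup>2))))" by (rule arg_cong)
      then show ?thesis unfolding M_def by (simp only: exp_add)
    qed
    then show ?thesis by (simp add: mult_ac)
  qed
  finally show ?thesis by (simp add: s_def)
qed

text \<open>
  In fact \<open>\<xi>(u) = ln u + ln (ln u) + o(1)\<close>; the constant \<open>11/10\<close> is a convenient number above 1.
\<close>

lemma eventually_xi_le: "eventually (\<lambda>u. xi u \<le> 11 / 10 * ln u) at_top"
proof -
  have "eventually (\<lambda>u::real. u * (11 / 10 * ln u) \<le> exp (11 / 10 * ln u) - 1) at_top"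
    by real_asymp
  then show ?thesis
    using eventually_ge_at_top[of 2]
  proof eventually_elim
    case (elim u)
    then have "ln u > 0" by simp
    then have "u \<le> expm1_ratio (11 / 10 * ln u)"
      unfolding expm1_ratio_def using elim by (subst pos_le_divide_eq) auto
    then show ?case using \<open>ln u > 0\<close> elim by (subst xi_le_iff) auto
  qed
qed

text \<open>
  The constant \<open>21/100\<close> only has to lie between \<open>2 / \<pi>^2\<close>, which is less than \<open>0.203\<close>, and the
  rate \<open>1 / (2 * 1.7 * 1.1^2)\<close>, which is more than \<open>0.243\<close>.
\<close>

lemma eventually_saving_absorbs_powers:
  "eventually (\<lambda>u::real. (1 + 2 * u\<^sup>2)\<^sup>2 * (1 + 2 * (u + 2)\<^sup>2)\<^sup>2 *
      exp (- (u / (2 * (1 + 17 / 10 * (11 / 10 * ln u)\<^sup>2)))) \<le> exp (- (21 / 100 * u / (ln (1 + u))\<^sup>2))) at_top"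
proof -
  have "eventually (\<lambda>u::real. (1 + 2 * u\<^sup>2)\<^sup>2 * (1 + 2 * (u + 2)\<^sup>2)\<^sup>2 \<le> exp (1 / 100 * u / (ln u)\<^sup>2)) at_top"
    by real_asymp
  moreover have "eventually (\<lambda>u::real. 22 / 100 * u / (ln u)\<^sup>2 \<le> u / (2 * (1 + 17 / 10 * (11 / 10 * ln u)\<^sup>2))) at_top"
  proof -
    have "eventually (\<lambda>u::real. 3 \<le> ln u) at_top" by real_asymp
    then show ?thesis using eventually_gt_at_top[of 1]
    proof eventually_elim
      case (elim u)
      have "3\<^sup>2 \<le> (ln u)\<^sup>2" using elim by (intro power_mono) auto
      then have "2 * (1 + 17 / 10 * (11 / 10 * ln u)\<^sup>2) \<le> 100 / 22 * (ln u)\<^sup>2"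
        by (simp add: power_mult_distrib power_divide)
      then have "u / (100 / 22 * (ln u)\<^sup>2) \<le> u / (2 * (1 + 17 / 10 * (11 / 10 * ln u)\<^sup>2))"
        using elim by (intro divide_left_mono) (auto intro!: mult_pos_pos add_pos_nonneg)
      then show ?case by simp
    qed
  qed
  ultimately show ?thesis
    using eventually_gt_at_top[of 1]
  proof eventually_elim
    case (elim u)
    have "(ln u)\<^sup>2 \<le> (ln (1 + u))\<^sup>2" using elim(3) by (intro power_mono) auto
    then have "21 / 100 * u / (ln (1 + u))\<^sup>2 \<le> 21 / 100 * u / (ln u)\<^sup>2"
      using elim(3) by (intro divide_left_mono) auto
    then have "1 / 100 * u / (ln u)\<^sup>2 - u / (2 * (1 + 17 / 10 * (11 / 10 * ln u)\<^sup>2)) \<le> - (21 / 100 * u / (ln (1 + u))\<^sup>2)"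
      using elim(2) by (simp add: add_divide_distrib[symmetric] algebra_simps)
    then have "exp (1 / 100 * u / (ln u)\<^sup>2) * exp (- (u / (2 * (1 + 17 / 10 * (11 / 10 * ln u)\<^sup>2)))) \<le>
        exp (- (21 / 100 * u / (ln (1 + u))\<^sup>2))"
      by (simp flip: exp_add)
    then show ?case
      by (rule order.trans[OF mult_right_mono[OF elim(1)], rotated]) simp
  qed
qed

lemma kappa_error_large:
  "\<exists>u0 C. \<forall>n r :: nat. 1 \<le> r \<and> ln (real n) \<le> real r \<and> u0 \<le> real n / real r \<longrightarrow>
     \<bar>kappa n r - exp (- harm r)\<bar> \<le> C * (dickman (real n / real r) / real r *
        exp (real n / real r * ln (real n / real r) / real r - 21 / 100 * (real n / real r) / (ln (1 + real n / real r))\<^sup>2))"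
proof -
  define C where "C = 3 * exp 14 * (2 * exp (- legendre_ein 2))"
  have "eventually (\<lambda>u::real. (1 + 2 * u\<^sup>2)\<^sup>2 * (1 + 2 * (u + 2)\<^sup>2)\<^sup>2 *
      exp (- (u / (2 * (1 + 17 / 10 * (11 / 10 * ln u)\<^sup>2)))) \<le> exp (- (21 / 100 * u / (ln (1 + u))\<^sup>2))) at_top"
    by (rule eventually_saving_absorbs_powers)
  moreover note eventually_xi_le eventually_ge_at_top[of 4]
  ultimately have "eventually (\<lambda>u::real. (1 + 2 * u\<^sup>2)\<^sup>2 * (1 + 2 * (u + 2)\<^sup>2)\<^sup>2 *
      exp (- (u / (2 * (1 + 17 / 10 * (11 / 10 * ln u)\<^sup>2)))) \<le> exp (- (21 / 100 * u / (ln (1 + u))\<^sup>2)) \<and>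
      xi u \<le> 11 / 10 * ln u \<and> 4 \<le> u) at_top"
    by eventually_elim simp
  then obtain u0 where u0: "\<And>u. u \<ge> u0 \<Longrightarrow> (1 + 2 * u\<^sup>2)\<^sup>2 * (1 + 2 * (u + 2)\<^sup>2)\<^sup>2 *
      exp (- (u / (2 * (1 + 17 / 10 * (11 / 10 * ln u)\<^sup>2)))) \<le> exp (- (21 / 100 * u / (ln (1 + u))\<^sup>2))"
      "\<And>u. u \<ge> u0 \<Longrightarrow> xi u \<le> 11 / 10 * ln u" "\<And>u. u \<ge> u0 \<Longrightarrow> 4 \<le> u"
    unfolding eventually_at_top_linorder by blast
  show ?thesis
  proof (rule exI[of _ u0], rule exI[of _ C], intro allI impI)
    fix n r :: nat
    assume h: "1 \<le> r \<and> ln (real n) \<le> real r \<and> u0 \<le> real n / real r"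
    define u where "u = real n / real r"
    define s where "s = xi u"
    define P where "P = (1 + 2 * u\<^sup>2)\<^sup>2"
    define R where "R = (1 + 2 * (u + 2)\<^sup>2)\<^sup>2"
    define D where "D = u / (2 * (1 + 17 / 10 * s\<^sup>2))"
    have rr: "1 \<le> real r" using h by simp
    note U = u0(2,3)[of u] u0(1)[of u]
    have u4: "u \<ge> 4" and sl: "s \<le> 11 / 10 * ln u" using U(1,2) h by (auto simp: u_def s_def)
    have s1: "1 \<le> s" using xi(1)[of u] u4 by (simp add: s_def)
    have nu: "real n = u * r" using rr by (simp add: u_def)
    have "ln u \<le> ln n" unfolding nu using u4 rr by (simp add: mult_ge1_I)
    then have "s \<le> 11 / 10 * r" using sl h by linarith
    then have "xi u \<le> 6 / 5 * r" using rr by (simp add: s_def)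
    have "\<bar>kappa n r - exp (- harm r)\<bar> \<le> 3 * exp 14 * P / r * exp (- legendre_ein u + 3 / 4 * u * s / r - D)"
      unfolding P_def s_def D_def
      by (rule kappa_error_le_saddle) (use h nu u4 \<open>xi u \<le> 6 / 5 * r\<close> in auto)
    also have "\<dots> = 3 * exp 14 * P / r * (exp (- legendre_ein u) * exp (3 / 4 * u * s / r) * exp (- D))"
      by (simp only: exp_add exp_diff_conv_mult)
    also have "\<dots> \<le> 3 * exp 14 * P / r * ((2 * exp (- legendre_ein 2) * R * dickman u) * exp (u * ln u / r) *
        exp (- (u / (2 * (1 + 17 / 10 * (11 / 10 * ln u)\<^sup>2)))))"
    proof -
      have 1: "exp (- legendre_ein u) \<le> 2 * exp (- legendre_ein 2) * R * dickman u"
        using dickman_ge_legendre_ein[of u] u4 by (simp add: R_def)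
      have "3 / 4 * u * s \<le> u * ln u"
      proof -
        have "3 / 4 * s \<le> ln u" using sl u4 ln_ge_zero[of u] by linarith
        then have "u * (3 / 4 * s) \<le> u * ln u" using u4 by (intro mult_left_mono) auto
        then show ?thesis by (simp add: mult_ac)
      qed
      then have 2: "exp (3 / 4 * u * s / r) \<le> exp (u * ln u / r)"
        unfolding exp_le_cancel_iff by (rule divide_right_mono) simp
      have "s\<^sup>2 \<le> (11 / 10 * ln u)\<^sup>2" using sl s1 by (intro power_mono) auto
      then have "u / (2 * (1 + 17 / 10 * (11 / 10 * ln u)\<^sup>2)) \<le> D"
        unfolding D_def using u4 by (intro divide_left_mono) (auto intro!: mult_pos_pos add_pos_nonneg)
      then have 3: "exp (- D) \<le> exp (- (u / (2 * (1 + 17 / 10 * (11 / 10 * ln u)\<^sup>2))))" by simp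
      have "0 \<le> 3 * exp 14 * P / r" by (simp add: P_def)
      moreover have "0 \<le> 2 * exp (- legendre_ein 2) * R * dickman u"
        using dickman_pos[of u] u4 by (simp add: R_def)
      ultimately show ?thesis using 1 2 3 by (intro mult_left_mono mult_mono) auto
    qed
    also have "\<dots> = C * (dickman u / r * exp (u * ln u / r)) *
       (P * R * exp (- (u / (2 * (1 + 17 / 10 * (11 / 10 * ln u)\<^sup>2)))))"
      by (simp add: C_def)
    also have "\<dots> \<le> C * (dickman u / r * exp (u * ln u / r)) * exp (- (21 / 100 * u / (ln (1 + u))\<^sup>2))"
    proof (rule mult_left_mono)
      show "P * R * exp (- (u / (2 * (1 + 17 / 10 * (11 / 10 * ln u)\<^sup>2)))) \<le> exp (- (21 / 100 * u / (ln (1 + u))\<^sup>2))"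
        unfolding P_def R_def by (rule U(3)) (use h in \<open>simp add: u_def\<close>)
      show "0 \<le> C * (dickman u / r * exp (u * ln u / r))"
        using dickman_pos[of u] u4 by (simp add: C_def)
    qed
    also have "\<dots> = C * (dickman u / r * exp (u * ln u / r - 21 / 100 * u / (ln (1 + u))\<^sup>2))"
      by (simp only: exp_diff_conv_mult mult.assoc)
    finally show "\<bar>kappa n r - exp (- harm r)\<bar> \<le> C * (dickman (real n / real r) / real r *
        exp (real n / real r * ln (real n / real r) / real r - 21 / 100 * (real n / real r) / (ln (1 + real n / real r))\<^sup>2))"
      by (simp only: u_def)
  qed
qed

lemma exp_minus_harm_le:
  assumes "r \<ge> 1" shows "exp (- harm r) \<le> 1 / real r"
proof -
  have "real r + 1 = exp (ln (real r + 1))" by simp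
  also have "\<dots> \<le> exp (harm r)" by (simp only: exp_le_cancel_iff ln_le_harm)
  finally have "real r \<le> exp (harm r)" by linarith
  then show ?thesis using assms by (simp add: exp_minus field_simps)
qed

lemma abs_kappa_error_le:
  assumes "r \<ge> 1" "n \<ge> 1"
  shows "\<bar>kappa n r - exp (- harm r)\<bar> \<le> 1 / real r"
proof -
  have "kappa n r \<le> 1 / (real r + 1)" using kappa_le[of n r] assms by simp
  also have "\<dots> \<le> 1 / real r" using assms by (simp add: frac_le)
  finally show ?thesis
    using exp_minus_harm_le[OF assms(1)] kappa_nonneg[of n r] exp_ge_zero[of "- harm r"] by linarith
qed

text \<open>
  For bounded \<open>u\<close> the right-hand side is bounded below by a multiple of \<open>1/r\<close>, and the elementary
  bound for \<open>kappa\<close> suffices.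
\<close>

lemma kappa_error:
  "\<exists>C. \<forall>n r :: nat. 1 \<le> r \<and> r < n \<and> ln (real n) \<le> real r \<longrightarrow>
     \<bar>kappa n r - exp (- harm r)\<bar> \<le> C * (dickman (real n / real r) / real r *
        exp (real n / real r * ln (real n / real r) / real r - 21 / 100 * (real n / real r) / (ln (1 + real n / real r))\<^sup>2))"
proof -
  obtain u0 C where C: "\<And>n r. 1 \<le> r \<Longrightarrow> ln (real n) \<le> real r \<Longrightarrow> u0 \<le> real n / real r \<Longrightarrow>
     \<bar>kappa n r - exp (- harm r)\<bar> \<le> C * (dickman (real n / real r) / real r *
        exp (real n / real r * ln (real n / real r) / real r - 21 / 100 * (real n / real r) / (ln (1 + real n / real r))\<^sup>2))"
    using kappa_error_large by blast
  obtain c where c: "c > 0" "\<And>u. u \<in> {0..u0} \<Longrightarrow> c \<le> dickman u"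
    using dickman_bounded_below by blast
  (* a lower bound for the exponential factor in the range 1 < u < u0 *)
  define E where "E = exp (- (21 / 100 * u0 / (ln 2)\<^sup>2))"
  have E: "E > 0" by (simp add: E_def)
  define C' where "C' = max C (1 / (c * E))"
  show ?thesis
  proof (intro exI[of _ C'] allI impI)
    fix n r :: nat
    assume h: "1 \<le> r \<and> r < n \<and> ln (real n) \<le> real r"
    define u where "u = real n / real r"
    have rr: "1 \<le> real r" using h by simp
    have u1: "u > 1" using h by (simp add: u_def)
    define B where "B = dickman u / r * exp (u * ln u / r - 21 / 100 * u / (ln (1 + u))\<^sup>2)"
    have B0: "B \<ge> 0" unfolding B_def using dickman_pos[of u] u1 by simp
    have "\<bar>kappa n r - exp (- harm r)\<bar> \<le> C' * B"
    proof (cases "u0 \<le> u")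
      case True
      then have "\<bar>kappa n r - exp (- harm r)\<bar> \<le> C * B"
        using C[of r n] h unfolding B_def u_def by simp
      also have "\<dots> \<le> C' * B" using B0 by (intro mult_right_mono) (auto simp: C'_def)
      finally show ?thesis .
    next
      case False
      have "(ln 2)\<^sup>2 \<le> (ln (1 + u))\<^sup>2" using u1 by (intro power_mono) auto
      then have "21 / 100 * u / (ln (1 + u))\<^sup>2 \<le> 21 / 100 * u0 / (ln 2)\<^sup>2"
        using False u1 by (intro frac_le) auto
      moreover have "0 \<le> u * ln u / r" using u1 rr by simp
      ultimately have "E \<le> exp (u * ln u / r - 21 / 100 * u / (ln (1 + u))\<^sup>2)"
        unfolding E_def by simp
      moreover have "c / r \<le> dickman u / r" using c(2)[of u] False u1 by (intro divide_right_mono) auto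
      ultimately have "c / r * E \<le> B"
        unfolding B_def using c(1) E rr dickman_pos[of u] u1 by (intro mult_mono) auto
      then have "1 / (c * E) * (c / r * E) \<le> 1 / (c * E) * B" using c(1) E by (intro mult_left_mono) auto
      also have "1 / (c * E) * (c / r * E) = 1 / r" using c(1) E by (simp add: field_simps)
      finally have "1 / real r \<le> 1 / (c * E) * B" .
      also have "\<dots> \<le> C' * B" using B0 by (intro mult_right_mono) (auto simp: C'_def)
      finally show ?thesis using abs_kappa_error_le[of r n] h by linarith
    qed
    then show "\<bar>kappa n r - exp (- harm r)\<bar> \<le> C' * (dickman (real n / real r) / real r *
        exp (real n / real r * ln (real n / real r) / real r - 21 / 100 * (real n / real r) / (ln (1 + real n / real r))\<^sup>2))"
      by (simp add: B_def u_def)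
  qed
qed

lemma two_div_pi_squared: "2 / pi\<^sup>2 \<le> 20825 / 100000"
proof -
  have "(31 / 10 :: real)\<^sup>2 \<le> pi\<^sup>2" using pi_approx by (intro power_mono) auto
  then have "2 / pi\<^sup>2 \<le> 2 / (31 / 10)\<^sup>2" by (intro divide_left_mono) auto
  also have "\<dots> \<le> 20825 / 100000" by (simp add: power2_eq_square)
  finally show ?thesis .
qed

text \<open>
  This is where the exponent \<open>3 + \<epsilon>\<close> comes from: one logarithm is due to the factor \<open>u^{u/r}\<close>, two are
  due to the saving.
\<close>

lemma eventually_discretisation_negligible:
  assumes "\<epsilon> > 0"
  shows "eventually (\<lambda>u::real. u * ln u / ln u powr (3 + \<epsilon>) \<le> 1 / 1000 * u / (ln (1 + u))\<^sup>2) at_top"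
  using assms by real_asymp

theorem theorem3p3:
  shows
    "(\<forall>\<epsilon>>0. \<forall>\<delta>>0. \<exists>C::real. \<forall>n r :: nat.
        1 \<le> r \<and> r < n \<and> ln (real n) powr (3 + \<epsilon>) \<le> real r \<longrightarrow>
        (let u = real n / real r in
         \<bar>kappa n r - exp (- harm r)\<bar>
           \<le> C * (dickman u / real r *
                  exp (- (2 * u * (1 - \<delta>) / (pi\<^sup>2 * (ln (1 + u))\<^sup>2))))))
     \<and>
     (\<exists>C::real. \<forall>\<epsilon>>0. \<forall>n r :: nat.
        1 \<le> r \<and> r < n \<and> ln (real n) \<le> real r \<and> real r < ln (real n) powr (3 + \<epsilon>) \<longrightarrow>
        (let u = real n / real r in
         \<bar>kappa n r - exp (- harm r)\<bar>
           \<le> C * (dickman u * u powr (u / real r) / real r)))"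
proof -
  obtain C where C: "\<And>n r. 1 \<le> r \<Longrightarrow> r < n \<Longrightarrow> ln (real n) \<le> real r \<Longrightarrow>
     \<bar>kappa n r - exp (- harm r)\<bar> \<le> C * (dickman (real n / real r) / real r *
        exp (real n / real r * ln (real n / real r) / real r - 21 / 100 * (real n / real r) / (ln (1 + real n / real r))\<^sup>2))"
    using kappa_error by blast
  define C1 where "C1 = max C 0"
  have C1: "\<bar>kappa n r - exp (- harm r)\<bar> \<le> C1 * (dickman u / r *
        exp (u * ln u / r - 21 / 100 * u / (ln (1 + u))\<^sup>2))"
    if "1 \<le> r" "r < n" "ln (real n) \<le> real r" "u = real n / real r" for n r :: nat and u :: real
  proof -
    have "u \<ge> 0" using that by simp
    then show ?thesis
      using C[OF that(1-3)] mult_right_mono[of C C1 "dickman u / r * exp (u * ln u / r - 21 / 100 * u / (ln (1 + u))\<^sup>2)"]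
        dickman_pos[of u] that by (simp add: C1_def)
  qed
  have C1_0: "C1 \<ge> 0" by (simp add: C1_def)
  have "\<exists>C::real. \<forall>n r :: nat.
        1 \<le> r \<and> r < n \<and> ln (real n) powr (3 + \<epsilon>) \<le> real r \<longrightarrow>
        (let u = real n / real r in
         \<bar>kappa n r - exp (- harm r)\<bar>
           \<le> C * (dickman u / real r *
                  exp (- (2 * u * (1 - \<delta>) / (pi\<^sup>2 * (ln (1 + u))\<^sup>2)))))"
    if \<epsilon>: "\<epsilon> > 0" and \<delta>: "\<delta> > 0" for \<epsilon> \<delta> :: real
  proof -
    obtain u1 where u1: "\<And>u. u \<ge> u1 \<Longrightarrow> u * ln u / ln u powr (3 + \<epsilon>) \<le> 1 / 1000 * u / (ln (1 + u))\<^sup>2"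
      using eventually_discretisation_negligible[OF \<epsilon>] unfolding eventually_at_top_linorder by blast
    (* bounds u ln u / r in the range u < u1, where the asymptotic comparison is not available *)
    define A where "A = max 0 (u1 * ln u1)"
    show ?thesis
    proof (intro exI[of _ "C1 * exp A"] allI impI)
      fix n r :: nat
      assume h: "1 \<le> r \<and> r < n \<and> ln (real n) powr (3 + \<epsilon>) \<le> real r"
      define u where "u = real n / real r"
      have rr: "1 \<le> real r" using h by simp
      have u_gt: "u > 1" using h by (simp add: u_def)
      have lnu: "ln u > 0" using u_gt by simp
      have nu: "real n = u * r" using rr by (simp add: u_def)
      have un: "ln u \<le> ln n" unfolding nu using u_gt rr by (simp add: mult_ge1_I)
      have "ln (real n) \<le> real r"
      proof (cases "ln n \<ge> 1")
        case True
        then have "ln n powr 1 \<le> ln n powr (3 + \<epsilon>)" using \<epsilon> by (intro powr_mono) auto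
        then show ?thesis using h True by simp
      next
        case False
        then show ?thesis using rr by linarith
      qed
      note b = C1[OF _ _ this u_def]
      define l where "l = (ln (1 + u))\<^sup>2"
      have l: "l > 0" using u_gt by (simp add: l_def)
      have disc: "u * ln u / r \<le> A + 1 / 1000 * u / l"
      proof (cases "u1 \<le> u")
        case True
        have "ln u powr (3 + \<epsilon>) \<le> ln n powr (3 + \<epsilon>)"
          using un lnu \<epsilon> by (intro powr_mono2) auto
        then have "ln u powr (3 + \<epsilon>) \<le> r" using h by linarith
        then have "u * ln u / r \<le> u * ln u / ln u powr (3 + \<epsilon>)"
          using lnu u_gt rr by (intro divide_left_mono) auto
        also have "\<dots> \<le> 1 / 1000 * u / l" unfolding l_def by (rule u1[OF True])
        also have "\<dots> \<le> A + 1 / 1000 * u / l" by (simp add: A_def)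
        finally show ?thesis .
      next
        case False
        have "u * ln u / r \<le> u * ln u / 1" using rr lnu u_gt by (intro divide_left_mono) auto
        also have "\<dots> \<le> u1 * ln u1" using False u_gt lnu by (simp add: mult_mono)
        also have "\<dots> \<le> A" by (simp add: A_def)
        also have "\<dots> \<le> A + 1 / 1000 * u / l" using u_gt l by simp
        finally show ?thesis .
      qed
      have "2 * u * (1 - \<delta>) / (pi\<^sup>2 * l) = 2 / pi\<^sup>2 * (1 - \<delta>) * (u / l)"
        by simp
      also have "\<dots> \<le> 20825 / 100000 * (u / l)"
      proof (intro mult_right_mono)
        have "2 / pi\<^sup>2 * (1 - \<delta>) \<le> 2 / pi\<^sup>2 * 1" using \<delta> by (intro mult_left_mono) auto
        then show "2 / pi\<^sup>2 * (1 - \<delta>) \<le> 20825 / 100000" using two_div_pi_squared by linarith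
      qed (use u_gt l in auto)
      also have "\<dots> \<le> 209 / 1000 * (u / l)" using u_gt l by (intro mult_right_mono) auto
      finally have "u * ln u / r - 21 / 100 * u / l \<le> A + - (2 * u * (1 - \<delta>) / (pi\<^sup>2 * l))"
        using disc by simp
      then have "exp (u * ln u / r - 21 / 100 * u / l) \<le> exp A * exp (- (2 * u * (1 - \<delta>) / (pi\<^sup>2 * l)))"
        by (simp flip: exp_add)
      then have "C1 * (dickman u / r * exp (u * ln u / r - 21 / 100 * u / l)) \<le>
         C1 * (dickman u / r * (exp A * exp (- (2 * u * (1 - \<delta>) / (pi\<^sup>2 * l)))))"
        using C1_0 dickman_pos[of u] u_gt by (intro mult_left_mono) auto
      with b h have "\<bar>kappa n r - exp (- harm r)\<bar> \<le>
         C1 * (dickman u / r * (exp A * exp (- (2 * u * (1 - \<delta>) / (pi\<^sup>2 * l)))))"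
        by (simp add: l_def)
      then show "let u = real n / real r in
         \<bar>kappa n r - exp (- harm r)\<bar>
           \<le> C1 * exp A * (dickman u / real r *
                  exp (- (2 * u * (1 - \<delta>) / (pi\<^sup>2 * (ln (1 + u))\<^sup>2))))"
        unfolding Let_def u_def[symmetric] l_def[symmetric] by (simp only: mult_ac)
    qed
  qed
  moreover have "\<bar>kappa n r - exp (- harm r)\<bar> \<le> C1 * (dickman u * u powr (u / real r) / real r)"
    if h: "1 \<le> r" "r < n" "ln (real n) \<le> real r" and u: "u = real n / real r" for n r :: nat and u :: real
  proof -
    have u_gt: "u > 1" using h by (simp add: u)
    have "exp (u * ln u / r - 21 / 100 * u / (ln (1 + u))\<^sup>2) \<le> exp (u / r * ln u)"
      using u_gt by simp
    also have "\<dots> = u powr (u / r)" using u_gt by (simp add: powr_def)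
    finally have "C1 * (dickman u / r * exp (u * ln u / r - 21 / 100 * u / (ln (1 + u))\<^sup>2)) \<le>
       C1 * (dickman u / r * u powr (u / r))"
      using C1_0 dickman_pos[of u] u_gt by (intro mult_left_mono) auto
    then show ?thesis using C1[OF h u] by simp
  qed
  ultimately show ?thesis by (auto simp: Let_def intro!: exI[of _ C1])
qed

end
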